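(* Let $\Pi$ be a finite set of proposition symbols and $\Delta\in\mathbb{N}$. Given a $\Pi$-program of $\mathrm{MSC}$ of size $m$, there exists a message passing circuit (MPC) for $(\Pi,\Delta)$ of size $\mathcal{O}(\Delta m+|\Pi|)$ that is equivalent to the program. The computation time of the MPC is $\mathcal{O}(\max(1,d))$ times the computation time of the $\mathrm{MSC}$-program, where $d$ is the modal depth of the $\mathrm{MSC}$-program.
   Context: Proposition symbols: there is a countably infinite, linearly ordered set of proposition symbols partitioned into ordinary symbols and identifier symbols. For a finite set $\Pi$ of proposition symbols, $\Pi_1$ denotes its identifier symbols. A Kripke model over $\Pi$ is $M=(W,R,V)$ with $W\neq\emptyset$, $R\subseteq W\times W$, $V:\Pi\to\mathcal P(W)$. If $p_1,\dots,p_\ell$ list $\Pi_1$ in order, $\mathrm{ID}(w)$ is the $\ell$-bit string whose $i$th bit is $1$ iff $w\in V(p_i)$; $M$ has identifiers if $\mathrm{ID}$ is injective. The local input of $w$ is the $|\Pi|$-bit string whose $i$th bit is $1$ iff $w$ satisfies the $i$th symbol of $\Pi$. $\mathcal K(\Pi,\Delta)$ is the class of finite Kripke models over $\Pi$ with identifiers in which every node has out-degree at most $\Delta$. If the successors of $w$ have identifiers $s_1<\dots<s_d$ (lexicographic order), the successor with identifier $s_i$ is the $i$th neighbour of $w$. Acceptance of sequences: given a sequence $(\overline b_n)_{n}$ of $k$-bit strings and sets $A,P\subseteq[k]$ (attention and print positions), the sequence accepts in round $n$ if some position in $A$ of $\overline b_n$ is $1$ and all positions in $A$ of $\overline b_m$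 are $0$ for $m<n$; it then outputs the substring of $\overline b_n$ at positions in $P$. Circuits: a Boolean circuit is a DAG whose gates of nonzero in-degree are labelled $\wedge,\vee$ (any fan-in) or $\neg$ (fan-in 1); inputs (fan-in 0) and outputs (fan-out 0) are linearly ordered; size = number of gates. An MPC for $(\Pi,\Delta)$ is a circuit computing $\{0,1\}^{|\Pi|+k(\Delta+1)}\to\{0,1\}^k$ (some $k$) with sets $A,P\subseteq[k]$ of attention and print bits. On $M\in\mathcal K(\Pi,\Delta)$: $f_0(w)$ is the output of $C$ on $\overline t_w\cdot 0^{k(\Delta+1)}$ ($\overline t_w$ the local input); $f_{n+1}(w)$ is the output on $\overline t_w\cdot f_n(w)\cdot f_n(v_1)\cdots f_n(v_m)\cdot(0^k)^{\Delta-m}$, where $v_1,\dots,v_m$ are the neighbours of $w$ in order. Node $w$ accepts/outputs in round $n$ if $(f_n(w))_n$ does so w.r.t. $(k,A,P)$; that round is the computation time at $w$. MSC: $\mathrm{ML}(\Pi)$-formulas: $\varphi::=\top\mid p\mid\neg\varphi\mid(\varphi\wedge\varphi)\mid\Diamond\varphi$ ($p\in\Pi$), usual semantics. Schemata additionally allow schema variables. A $\Pi$-program of MSC has distinct head predicates $Y_1,\dots,Y_k$ (fixed order), terminal clauses $Y_i(0):=\varphi_i$ ($\varphi_i\in\mathrm{ML}(\Pi)$), iteration clauses $Y_i:=\psi_i$ ($\psi_i$ a schema over $\{Y_1,\dots,Y_k\}$), and sets of attention and print predicates among the heads. $Y_i^0=\varphi_i$ and $Y_i^{n+1}$ is $\psi_i$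 with each $Y_j$ replaced by $Y_j^n$. At node $w$, the round-$n$ configuration is the $k$-bit string with $i$th bit $1$ iff $(M,w)\models Y_i^n$; $w$ accepts/outputs in round $n$ if this sequence does so w.r.t. the positions of attention/print predicates; that round is the computation time. Size = number of occurrences of proposition symbols, head predicates, $\top,\neg,\wedge,\Diamond$. The modal depth of a program is the maximum nesting depth of $\Diamond$ in its terminal and iteration clause bodies. Equivalence: a program and an MPC for $(\Pi,\Delta)$ are equivalent if for every $M\in\mathcal K(\Pi,\Delta)$ interpreting all proposition symbols of the program and every node $w$, both produce the same output at $w$ or neither produces any output at $w$.
   Formalization: For Δ=0 the size bound is O(m+|Π|), as O(|Π|) is false; if the program accepts in round 0 and d>0, the time bound is O(d), as round 0 can be impossible for an MPC; programs have at least one head predicate; nodes of the finite models are natural numbers (general up to isomorphism). *)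

theory Defs
  imports Main "HOL-Library.Countable" "HOL-Library.List_Lexorder"
begin

text \<open>
  The proposition symbols are the elements of a type \<open>'p\<close>, and \<open>I :: 'p set\<close> is the set of
  identifier symbols; the remaining elements of \<open>'p\<close> are the ordinary symbols. Positions in bit
  strings are counted from 0.
\<close>

section \<open>Kripke models\<close>

record ('w, 'p) kripke =
  worlds :: "'w set"
  acc :: "('w \<times> 'w) set"
  val :: "'p \<Rightarrow> 'w set"

text \<open>Values of the valuation outside \<open>\<Pi>\<close> are arbitrary, and irrelevant to everything below.\<close>

definition kripke_over :: "'p set \<Rightarrow> ('w, 'p) kripke \<Rightarrow> bool" where
  "kripke_over \<Pi> M \<longleftrightarrow>
     worlds M \<noteq> {} \<and> acc M \<subseteq> worlds M \<times> worlds M \<and> (\<forall>p\<in>\<Pi>. val M p \<subseteq> worlds M)"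

definition local_input :: "'p::linorder set \<Rightarrow> ('w, 'p) kripke \<Rightarrow> 'w \<Rightarrow> bool list" where
  "local_input \<Pi> M w = map (\<lambda>p. w \<in> val M p) (sorted_list_of_set \<Pi>)"

definition ID :: "'p::linorder set \<Rightarrow> 'p set \<Rightarrow> ('w, 'p) kripke \<Rightarrow> 'w \<Rightarrow> bool list" where
  "ID I \<Pi> M w = map (\<lambda>p. w \<in> val M p) (sorted_list_of_set (\<Pi> \<inter> I))"

definition has_identifiers :: "'p::linorder set \<Rightarrow> 'p set \<Rightarrow> ('w, 'p) kripke \<Rightarrow> bool" where
  "has_identifiers I \<Pi> M \<longleftrightarrow> inj_on (ID I \<Pi> M) (worlds M)"

definition successors :: "('w, 'p) kripke \<Rightarrow> 'w \<Rightarrow> 'w set" where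
  "successors M w = {v. (w, v) \<in> acc M}"

definition \<K> :: "'p::linorder set \<Rightarrow> 'p set \<Rightarrow> nat \<Rightarrow> ('w, 'p) kripke set" where
  "\<K> I \<Pi> \<Delta> = {M. kripke_over \<Pi> M \<and> finite (worlds M) \<and> has_identifiers I \<Pi> M \<and>
                  (\<forall>w\<in>worlds M. card (successors M w) \<le> \<Delta>)}"

text \<open>Identifiers are compared by the lexicographic order on lists from \<open>List_Lexorder\<close>.\<close>

definition neighbours :: "'p::linorder set \<Rightarrow> 'p set \<Rightarrow> ('w, 'p) kripke \<Rightarrow> 'w \<Rightarrow> 'w list" where
  "neighbours I \<Pi> M w = sorted_key_list_of_set (ID I \<Pi> M) (successors M w)"

lemma neighbours_sorted:
  assumes "M \<in> \<K> I \<Pi> \<Delta>" "w \<in> worlds M"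
  shows "set (neighbours I \<Pi> M w) = successors M w \<and>
         sorted (map (ID I \<Pi> M) (neighbours I \<Pi> M w)) \<and>
         distinct (map (ID I \<Pi> M) (neighbours I \<Pi> M w))"
proof -
  have s: "successors M w \<subseteq> worlds M" and f: "finite (worlds M)" and i: "inj_on (ID I \<Pi> M) (worlds M)"
    using assms by (auto simp: \<K>_def kripke_over_def successors_def has_identifiers_def)
  interpret F: folding_insort_key "(\<le>)" "(<)" "worlds M" "ID I \<Pi> M"
    by unfold_locales (rule i)
  have e: "linorder.sorted_key_list_of_set (\<le>) = (sorted_key_list_of_set :: ('a \<Rightarrow> bool list) \<Rightarrow> _)"
    by (intro ext) (simp add: linorder.sorted_key_list_of_set_def[OF linorder_axioms] sorted_key_list_of_set_def linorder.insort_key_def[OF linorder_axioms] insort_key_def)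
  have "finite (successors M w)" using s f finite_subset by blast
  then show ?thesis unfolding neighbours_def using F.sorted_key_list_of_set[OF s] e
    by metis
qed


section \<open>Acceptance and output of sequences of bit strings\<close>

definition accepts_in :: "nat set \<Rightarrow> (nat \<Rightarrow> bool list) \<Rightarrow> nat \<Rightarrow> bool" where
  "accepts_in A b n \<longleftrightarrow> (\<exists>i\<in>A. b n ! i) \<and> (\<forall>m<n. \<forall>i\<in>A. \<not> b m ! i)"

definition outputs :: "nat set \<Rightarrow> nat set \<Rightarrow> (nat \<Rightarrow> bool list) \<Rightarrow> bool list \<Rightarrow> bool" where
  "outputs A P b s \<longleftrightarrow> (\<exists>n. accepts_in A b n \<and> s = nths (b n) P)"


section \<open>Boolean circuits\<close>

datatype gate_label = AND | OR | NOT

record circuit =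
  gates :: "nat set"
  wires :: "(nat \<times> nat) set"
  gate_label :: "nat \<Rightarrow> gate_label"
  ins :: "nat list"
  outs :: "nat list"

definition preds :: "circuit \<Rightarrow> nat \<Rightarrow> nat set" where
  "preds C g = {h. (h, g) \<in> wires C}"

definition succs :: "circuit \<Rightarrow> nat \<Rightarrow> nat set" where
  "succs C g = {h. (g, h) \<in> wires C}"

text \<open>The inputs are exactly the gates of fan-in 0 and the outputs exactly those of fan-out 0. In
  particular every gate that is not an output, inputs included, is wired to some other gate.\<close>

definition wf_circuit :: "circuit \<Rightarrow> bool" where
  "wf_circuit C \<longleftrightarrow>
     finite (gates C) \<and> wires C \<subseteq> gates C \<times> gates C \<and> acyclic (wires C) \<and>
     distinct (ins C) \<and> set (ins C) = {g \<in> gates C. preds C g = {}} \<and>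
     distinct (outs C) \<and> set (outs C) = {g \<in> gates C. succs C g = {}} \<and>
     (\<forall>g\<in>gates C. preds C g \<noteq> {} \<and> gate_label C g = NOT \<longrightarrow> card (preds C g) = 1)"

definition circuit_size :: "circuit \<Rightarrow> nat" where
  "circuit_size C = card (gates C)"

definition gate_step :: "circuit \<Rightarrow> bool list \<Rightarrow> (nat \<Rightarrow> bool) \<Rightarrow> nat \<Rightarrow> bool" where
  "gate_step C x v g =
     (if preds C g = {} then map_of (zip (ins C) x) g = Some True
      else case gate_label C g of
          AND \<Rightarrow> \<forall>h\<in>preds C g. v h
        | OR \<Rightarrow> \<exists>h\<in>preds C g. v h
        | NOT \<Rightarrow> \<forall>h\<in>preds C g. \<not> v h)"

definition gate_value :: "circuit \<Rightarrow> bool list \<Rightarrow> nat \<Rightarrow> bool" where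
  "gate_value C x = wfrec (wires C) (gate_step C x)"

lemma gate_value_rec:
  assumes "wf_circuit C"
  shows "gate_value C x g = gate_step C x (gate_value C x) g"
proof -
  have "finite (wires C)"
    using assms finite_subset unfolding wf_circuit_def by blast
  then have wf: "wf (wires C)"
    using assms finite_acyclic_wf unfolding wf_circuit_def by blast
  have "gate_step C x (cut (gate_value C x) (wires C) g) g = gate_step C x (gate_value C x) g"
    unfolding gate_step_def by (auto simp: preds_def cut_def split: gate_label.split)
  then show ?thesis
    unfolding gate_value_def using wfrec[OF wf, of "gate_step C x" g] by simp
qed

definition circuit_output :: "circuit \<Rightarrow> bool list \<Rightarrow> bool list" where
  "circuit_output C x = map (gate_value C x) (outs C)"


section \<open>Message passing circuits\<close>

record mpc =
  circ :: circuit
  att_bits :: "nat set"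
  print_bits :: "nat set"

definition mpc_width :: "mpc \<Rightarrow> nat" where
  "mpc_width N = length (outs (circ N))"

definition is_mpc :: "'p set \<Rightarrow> nat \<Rightarrow> mpc \<Rightarrow> bool" where
  "is_mpc \<Pi> \<Delta> N \<longleftrightarrow>
     wf_circuit (circ N) \<and>
     length (ins (circ N)) = card \<Pi> + mpc_width N * (\<Delta> + 1) \<and>
     att_bits N \<subseteq> {..<mpc_width N} \<and> print_bits N \<subseteq> {..<mpc_width N}"

definition mpc_size :: "mpc \<Rightarrow> nat" where
  "mpc_size N = circuit_size (circ N)"

primrec mpc_conf ::
  "'p::linorder set \<Rightarrow> 'p set \<Rightarrow> nat \<Rightarrow> mpc \<Rightarrow> ('w, 'p) kripke \<Rightarrow> nat \<Rightarrow> 'w \<Rightarrow> bool list" where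
  "mpc_conf I \<Pi> \<Delta> N M 0 = (\<lambda>w.
     circuit_output (circ N)
       (local_input \<Pi> M w @ replicate (mpc_width N * (\<Delta> + 1)) False))"
| "mpc_conf I \<Pi> \<Delta> N M (Suc n) = (\<lambda>w.
     circuit_output (circ N)
       (local_input \<Pi> M w @ mpc_conf I \<Pi> \<Delta> N M n w @
        concat (map (mpc_conf I \<Pi> \<Delta> N M n) (neighbours I \<Pi> M w)) @
        replicate (mpc_width N * (\<Delta> - length (neighbours I \<Pi> M w))) False))"


section \<open>Modal logic and MSC\<close>

datatype (fml_props: 'p) fml =
  Top | Prop 'p | Neg "'p fml" | Conj "'p fml" "'p fml" | Dia "'p fml"

datatype (schema_props: 'p) schema =
  STop | SProp 'p | SVar nat | SNeg "'p schema" | SConj "'p schema" "'p schema" | SDia "'p schema"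

primrec sat :: "('w, 'p) kripke \<Rightarrow> 'w \<Rightarrow> 'p fml \<Rightarrow> bool" where
  "sat M w Top \<longleftrightarrow> True"
| "sat M w (Prop p) \<longleftrightarrow> w \<in> val M p"
| "sat M w (Neg \<phi>) \<longleftrightarrow> \<not> sat M w \<phi>"
| "sat M w (Conj \<phi> \<psi>) \<longleftrightarrow> sat M w \<phi> \<and> sat M w \<psi>"
| "sat M w (Dia \<phi>) \<longleftrightarrow> (\<exists>v. (w, v) \<in> acc M \<and> sat M v \<phi>)"

primrec schema_vars :: "'p schema \<Rightarrow> nat set" where
  "schema_vars STop = {}"
| "schema_vars (SProp p) = {}"
| "schema_vars (SVar j) = {j}"
| "schema_vars (SNeg \<phi>) = schema_vars \<phi>"
| "schema_vars (SConj \<phi> \<psi>) = schema_vars \<phi> \<union> schema_vars \<psi>"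
| "schema_vars (SDia \<phi>) = schema_vars \<phi>"

primrec inst :: "(nat \<Rightarrow> 'p fml) \<Rightarrow> 'p schema \<Rightarrow> 'p fml" where
  "inst \<sigma> STop = Top"
| "inst \<sigma> (SProp p) = Prop p"
| "inst \<sigma> (SVar j) = \<sigma> j"
| "inst \<sigma> (SNeg \<phi>) = Neg (inst \<sigma> \<phi>)"
| "inst \<sigma> (SConj \<phi> \<psi>) = Conj (inst \<sigma> \<phi>) (inst \<sigma> \<psi>)"
| "inst \<sigma> (SDia \<phi>) = Dia (inst \<sigma> \<phi>)"

primrec fml_size :: "'p fml \<Rightarrow> nat" where
  "fml_size Top = 1"
| "fml_size (Prop p) = 1"
| "fml_size (Neg \<phi>) = 1 + fml_size \<phi>"
| "fml_size (Conj \<phi> \<psi>) = 1 + fml_size \<phi> + fml_size \<psi>"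
| "fml_size (Dia \<phi>) = 1 + fml_size \<phi>"

primrec schema_size :: "'p schema \<Rightarrow> nat" where
  "schema_size STop = 1"
| "schema_size (SProp p) = 1"
| "schema_size (SVar j) = 1"
| "schema_size (SNeg \<phi>) = 1 + schema_size \<phi>"
| "schema_size (SConj \<phi> \<psi>) = 1 + schema_size \<phi> + schema_size \<psi>"
| "schema_size (SDia \<phi>) = 1 + schema_size \<phi>"

primrec fml_depth :: "'p fml \<Rightarrow> nat" where
  "fml_depth Top = 0"
| "fml_depth (Prop p) = 0"
| "fml_depth (Neg \<phi>) = fml_depth \<phi>"
| "fml_depth (Conj \<phi> \<psi>) = max (fml_depth \<phi>) (fml_depth \<psi>)"
| "fml_depth (Dia \<phi>) = 1 + fml_depth \<phi>"

primrec schema_depth :: "'p schema \<Rightarrow> nat" where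
  "schema_depth STop = 0"
| "schema_depth (SProp p) = 0"
| "schema_depth (SVar j) = 0"
| "schema_depth (SNeg \<phi>) = schema_depth \<phi>"
| "schema_depth (SConj \<phi> \<psi>) = max (schema_depth \<phi>) (schema_depth \<psi>)"
| "schema_depth (SDia \<phi>) = 1 + schema_depth \<phi>"

text \<open>The head predicates of a program with \<open>k\<close> heads are, in order, the variables \<open>0, \<dots>, k - 1\<close>;
  head \<open>i\<close> has the terminal body \<open>term_bodies \<Lambda> ! i\<close> and the iteration body
  \<open>iter_bodies \<Lambda> ! i\<close>.\<close>

record 'p program =
  term_bodies :: "'p fml list"
  iter_bodies :: "'p schema list"
  att_heads :: "nat set"
  print_heads :: "nat set"

definition heads :: "'p program \<Rightarrow> nat" where
  "heads \<Lambda> = length (term_bodies \<Lambda>)"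

definition is_program :: "'p set \<Rightarrow> 'p program \<Rightarrow> bool" where
  "is_program \<Pi> \<Lambda> \<longleftrightarrow>
     heads \<Lambda> \<ge> 1 \<and> length (iter_bodies \<Lambda>) = heads \<Lambda> \<and>
     (\<forall>\<phi>\<in>set (term_bodies \<Lambda>). fml_props \<phi> \<subseteq> \<Pi>) \<and>
     (\<forall>\<psi>\<in>set (iter_bodies \<Lambda>). schema_props \<psi> \<subseteq> \<Pi> \<and> schema_vars \<psi> \<subseteq> {..<heads \<Lambda>}) \<and>
     att_heads \<Lambda> \<subseteq> {..<heads \<Lambda>} \<and> print_heads \<Lambda> \<subseteq> {..<heads \<Lambda>}"

text \<open>The summand 1 for each clause is the occurrence of the head predicate on its left-hand side.\<close>

definition program_size :: "'p program \<Rightarrow> nat" where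
  "program_size \<Lambda> = (\<Sum>\<phi>\<leftarrow>term_bodies \<Lambda>. 1 + fml_size \<phi>) + (\<Sum>\<psi>\<leftarrow>iter_bodies \<Lambda>. 1 + schema_size \<psi>)"

definition modal_depth :: "'p program \<Rightarrow> nat" where
  "modal_depth \<Lambda> = Max (fml_depth ` set (term_bodies \<Lambda>) \<union> schema_depth ` set (iter_bodies \<Lambda>))"

primrec iter_fml :: "'p program \<Rightarrow> nat \<Rightarrow> nat \<Rightarrow> 'p fml" where
  "iter_fml \<Lambda> 0 = (\<lambda>i. term_bodies \<Lambda> ! i)"
| "iter_fml \<Lambda> (Suc n) = (\<lambda>i. inst (iter_fml \<Lambda> n) (iter_bodies \<Lambda> ! i))"

definition program_conf :: "'p program \<Rightarrow> ('w, 'p) kripke \<Rightarrow> nat \<Rightarrow> 'w \<Rightarrow> bool list" where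
  "program_conf \<Lambda> M n w = map (\<lambda>i. sat M w (iter_fml \<Lambda> n i)) [0..<heads \<Lambda>]"


section \<open>Acceptance at nodes and equivalence\<close>

definition program_accepts_in :: "'p program \<Rightarrow> ('w, 'p) kripke \<Rightarrow> 'w \<Rightarrow> nat \<Rightarrow> bool" where
  "program_accepts_in \<Lambda> M w = accepts_in (att_heads \<Lambda>) (\<lambda>n. program_conf \<Lambda> M n w)"

definition program_outputs :: "'p program \<Rightarrow> ('w, 'p) kripke \<Rightarrow> 'w \<Rightarrow> bool list \<Rightarrow> bool" where
  "program_outputs \<Lambda> M w = outputs (att_heads \<Lambda>) (print_heads \<Lambda>) (\<lambda>n. program_conf \<Lambda> M n w)"

definition mpc_accepts_in ::
  "'p::linorder set \<Rightarrow> 'p set \<Rightarrow> nat \<Rightarrow> mpc \<Rightarrow> ('w, 'p) kripke \<Rightarrow> 'w \<Rightarrow> nat \<Rightarrow> bool" where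
  "mpc_accepts_in I \<Pi> \<Delta> N M w = accepts_in (att_bits N) (\<lambda>n. mpc_conf I \<Pi> \<Delta> N M n w)"

definition mpc_outputs ::
  "'p::linorder set \<Rightarrow> 'p set \<Rightarrow> nat \<Rightarrow> mpc \<Rightarrow> ('w, 'p) kripke \<Rightarrow> 'w \<Rightarrow> bool list \<Rightarrow> bool" where
  "mpc_outputs I \<Pi> \<Delta> N M w = outputs (att_bits N) (print_bits N) (\<lambda>n. mpc_conf I \<Pi> \<Delta> N M n w)"

text \<open>Models with worlds in \<open>nat\<close> represent all finite models up to isomorphism. A \<open>\<Pi>\<close>-program
  mentions only symbols in \<open>\<Pi>\<close>, so every model over \<open>\<Pi>\<close> interprets all of its symbols.\<close>

definition equivalent :: "'p::linorder set \<Rightarrow> 'p set \<Rightarrow> nat \<Rightarrow> 'p program \<Rightarrow> mpc \<Rightarrow> bool" where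
  "equivalent I \<Pi> \<Delta> \<Lambda> N \<longleftrightarrow>
     (\<forall>M :: (nat, 'p) kripke. M \<in> \<K> I \<Pi> \<Delta> \<longrightarrow> (\<forall>w\<in>worlds M.
        (\<exists>s. program_outputs \<Lambda> M w s \<and> mpc_outputs I \<Pi> \<Delta> N M w s) \<or>
        (\<nexists>s. program_outputs \<Lambda> M w s) \<and> (\<nexists>s. mpc_outputs I \<Pi> \<Delta> N M w s)))"

text \<open>
  The bound \<open>O(max 1 d) \<cdot> n\<close> on the running time, with the program accepting in round \<open>n\<close>. Rounds
  are counted from 0, and an MPC has received no messages in round 0, whereas the terminal clauses
  may look \<open>d\<close> steps ahead; so nothing can be purely proportional to \<open>n\<close> when \<open>n = 0 < d\<close>. The
  summand \<open>d\<close> accounts for this; when \<open>n \<ge> 1\<close> it is at most \<open>max 1 d * n\<close>, and when \<open>d = 0\<close> it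
  vanishes.
\<close>

definition simulation_time_le ::
  "nat \<Rightarrow> 'p::linorder set \<Rightarrow> 'p set \<Rightarrow> nat \<Rightarrow> 'p program \<Rightarrow> mpc \<Rightarrow> bool" where
  "simulation_time_le c I \<Pi> \<Delta> \<Lambda> N \<longleftrightarrow>
     (\<forall>M :: (nat, 'p) kripke. M \<in> \<K> I \<Pi> \<Delta> \<longrightarrow> (\<forall>w\<in>worlds M. \<forall>n t.
        program_accepts_in \<Lambda> M w n \<and> mpc_accepts_in I \<Pi> \<Delta> N M w t \<longrightarrow>
        t \<le> c * (max 1 (modal_depth \<Lambda>) * n + modal_depth \<Lambda>)))"

end

theory Submission
  imports Defs
begin

text \<open>Every subschema occurrence of the program gets a gate whose value is part of the state, so that
  a diamond is the disjunction of the bits of its argument in the neighbours' previous states. Its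
  value is therefore one round late, and a body of modal depth at most \<open>d\<close> becomes correct after
  the heads were kept constant for \<open>d\<close> rounds. All nodes run a clock modulo \<open>d + 1\<close> and
  update the heads when it reaches \<open>d\<close>, so round \<open>n\<close> of the program is finished in round
  \<open>(n + 1) (d + 1) - 1\<close> of the circuit. Gates have unbounded fan-in, so only the number of
  inputs depends on \<open>\<Delta>\<close>.\<close>

section \<open>Message passing circuits from arrays of cells\<close>

text \<open>Two obstacles shape the construction. The circuit format admits neither constants nor
  idle wires: fan-in 0 marks inputs, fan-out 0 marks outputs, and the number of inputs is dictated
  by the width of the state. Hence some cell must read every input, and constants arise as a
  tautology and a contradiction over it. The second obstacle is premature acceptance: between
  updates the subschema cells may mix values of different rounds. Attention bits are therefore
  placed only on head registers, which are zero before the first update and change only at updates;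
  each configuration of the program is then repeated and its first acceptance survives. The zero
  messages of round 0 double as initial register contents. The clock needs one register per unit of
  depth, which is affordable because the depth is at most the program size.\<close>

datatype 'p src = Loc 'p | Own nat | Nbr nat | Cur nat

type_synonym 'p cell = "gate_label \<times> 'p src set"

text \<open>\<open>Nbr\<close> is confined to OR because the slots of missing neighbours are zero,
  which is neutral only there. A source other than \<open>Nbr\<close> keeps the fan-in nonzero when
  \<Delta> = 0. \<open>Cur\<close> looks only at earlier cells, which rules out cycles.\<close>

definition cell_ok :: "'p set \<Rightarrow> nat \<Rightarrow> nat \<Rightarrow> 'p cell \<Rightarrow> bool" where
  "cell_ok \<Pi> W i c \<longleftrightarrow>
     (\<forall>s\<in>snd c. case s of Loc p \<Rightarrow> p \<in> \<Pi> | Own j \<Rightarrow> j < W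
        | Nbr j \<Rightarrow> j < W \<and> fst c = OR | Cur j \<Rightarrow> j < i) \<and>
     (\<exists>s\<in>snd c. s \<notin> range Nbr) \<and> (fst c = NOT \<longrightarrow> (\<exists>s. snd c = {s}))"

definition cell_value :: "('p src \<Rightarrow> bool) \<Rightarrow> 'p cell \<Rightarrow> bool" where
  "cell_value f c = (case fst c of AND \<Rightarrow> \<forall>s\<in>snd c. f s | OR \<Rightarrow> \<exists>s\<in>snd c. f s
     | NOT \<Rightarrow> \<forall>s\<in>snd c. \<not> f s)"

text \<open>The default \<open>False\<close> in round 0 stands for the all-zero messages of the
  first evaluation.\<close>

definition prev :: "(nat \<Rightarrow> bool) \<Rightarrow> nat \<Rightarrow> bool" where
  "prev f t = (case t of 0 \<Rightarrow> False | Suc t' \<Rightarrow> f t')"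

lemma prev_simps [simp]: "prev f 0 = False" "prev f (Suc t) = f t"
  by (simp_all add: prev_def)

fun src_value ::
  "('w, 'p) kripke \<Rightarrow> (nat \<Rightarrow> 'w \<Rightarrow> nat \<Rightarrow> bool) \<Rightarrow> nat \<Rightarrow> 'w \<Rightarrow> 'p src \<Rightarrow> bool" where
  "src_value M V t w (Loc p) \<longleftrightarrow> w \<in> val M p"
| "src_value M V t w (Own j) \<longleftrightarrow> prev (\<lambda>t. V t w j) t"
| "src_value M V t w (Nbr j) \<longleftrightarrow> prev (\<lambda>t. \<exists>v\<in>successors M w. V t v j) t"
| "src_value M V t w (Cur j) \<longleftrightarrow> V t w j"

lemma length_concat_upt: "length (concat (map f [0..<n])) = (\<Sum>i<n. length (f i))"
  by (induction n) auto

text \<open>Serves twice: for message slots, all of one length, and for blocks of compiled schemata,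
  whose lengths vary.\<close>

lemma nth_concat_upt:
  assumes "j < K" "l < length (f j)"
  shows "concat (map f [0..<K]) ! ((\<Sum>i<j. length (f i)) + l) = f j ! l"
proof -
  have "concat (map f [0..<K]) = concat (map f [0..<j]) @ f j @ concat (map f [Suc j..<K])"
  proof -
    have "[0..<K] = [0..<j] @ j # [Suc j..<K]"
      using assms(1) upt_add_eq_append[of 0 j "K - j"] by (simp add: upt_conv_Cons)
    then show ?thesis by simp
  qed
  then show ?thesis using assms(2) length_concat_upt[of f j] by (simp add: nth_append)
qed

lemma length_mpc_conf: "length (mpc_conf I \<Pi> \<Delta> N M t w) = mpc_width N"
  by (cases t) (simp_all add: circuit_output_def mpc_width_def)

locale cell_array =
  fixes \<Pi> :: "'p::linorder set" and \<Delta> :: nat and cs :: "'p cell list"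
  assumes finite_props: "finite \<Pi>"
    and cells_ok: "i < length cs \<Longrightarrow> cell_ok \<Pi> (length cs) i (cs ! i)"
    and reads_all: "Loc ` \<Pi> \<union> Own ` {..<length cs} \<union> Nbr ` {..<length cs}
      \<subseteq> (\<Union>i<length cs. snd (cs ! i))"
begin

abbreviation "W \<equiv> length cs"

definition base :: nat where
  "base = card \<Pi> + W * (\<Delta> + 1)"

text \<open>The gates that carry a source: exactly one for \<open>Own\<close>, \<open>Cur\<close>
  and for \<open>Loc p\<close> with \<open>p\<close> in \<Pi>, but one per message slot for
  \<open>Nbr\<close>.\<close>

fun addr :: "'p src \<Rightarrow> nat set" where
  "addr (Loc p) = {i. i < card \<Pi> \<and> sorted_list_of_set \<Pi> ! i = p}"
| "addr (Own j) = {card \<Pi> + j}"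
| "addr (Nbr j) = (\<lambda>s. card \<Pi> + (W + (s * W + j))) ` {..<\<Delta>}"
| "addr (Cur j) = {base + j}"

definition cell_preds :: "nat \<Rightarrow> nat set" where
  "cell_preds i = (\<Union>s\<in>snd (cs ! i). addr s)"

text \<open>Every cell is copied to an output gate of its own, which gives it nonzero fan-out and makes
  its value part of the state.\<close>

definition array_circuit :: circuit where
  "array_circuit = \<lparr>gates = {..<base + 2 * W},
     wires = {(a, b). \<exists>i<W. b = base + i \<and> a \<in> cell_preds i \<or> a = base + i \<and> b = base + W + i},
     gate_label = (\<lambda>g. if g < base + W then fst (cs ! (g - base)) else AND),
     ins = [0..<base], outs = [base + W..<base + 2 * W]\<rparr>"

definition array_mpc :: "nat set \<Rightarrow> nat set \<Rightarrow> mpc" where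
  "array_mpc A Q = \<lparr>circ = array_circuit, att_bits = A, print_bits = Q\<rparr>"

section \<open>Well-formedness of the array circuit\<close>

lemma addr_Loc:
  assumes "p \<in> \<Pi>"
  obtains i where "i < card \<Pi>" "sorted_list_of_set \<Pi> ! i = p" "addr (Loc p) = {i}"
proof -
  have "p \<in> set (sorted_list_of_set \<Pi>)" using assms finite_props by simp
  then obtain i where i: "i < card \<Pi>" "sorted_list_of_set \<Pi> ! i = p"
    by (metis in_set_conv_nth length_sorted_list_of_set)
  moreover have "addr (Loc p) = {i}"
    using i distinct_sorted_list_of_set[of \<Pi>] by (auto simp: nth_eq_iff_index_eq)
  ultimately show ?thesis using that by blast
qed

lemma slot_bound: "s < \<Delta> \<Longrightarrow> j < W \<Longrightarrow> W + (s * W + j) < W * (\<Delta> + 1)"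
proof -
  assume "s < \<Delta>" "j < W"
  then have "s * W + j < Suc s * W" "Suc s * W \<le> \<Delta> * W"
    by (simp, intro mult_le_mono1) simp
  then show ?thesis by (simp add: algebra_simps)
qed

text \<open>Makes the gate numbering a topological order, which yields acyclicity and shows that
  output gates feed nothing.\<close>

lemma preds_less: "i < W \<Longrightarrow> a \<in> cell_preds i \<Longrightarrow> a < base + i"
proof -
  assume i: "i < W" and "a \<in> cell_preds i"
  then obtain s where s: "s \<in> snd (cs ! i)" "a \<in> addr s" by (auto simp: cell_preds_def)
  note ok = cells_ok[OF i, unfolded cell_ok_def, THEN conjunct1, rule_format, OF s(1)]
  show ?thesis
  proof (cases s)
    case (Nbr j)
    then show ?thesis using s(2) ok slot_bound by (fastforce simp: base_def)
  qed (use s(2) ok in \<open>auto simp: base_def\<close>)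
qed

lemma preds_cell: "i < W \<Longrightarrow> preds array_circuit (base + i) = cell_preds i"
  using preds_less by (auto simp: preds_def array_circuit_def)

lemma preds_out: "i < W \<Longrightarrow> preds array_circuit (base + W + i) = {base + i}"
  by (auto simp: preds_def array_circuit_def)

lemma preds_in: "g < base \<Longrightarrow> preds array_circuit g = {}"
  by (auto simp: preds_def array_circuit_def)

lemma cell_preds_nonempty:
  assumes "i < W" shows "cell_preds i \<noteq> {}"
proof -
  obtain s where s: "s \<in> snd (cs ! i)" "s \<notin> range Nbr"
    using cells_ok[OF assms] by (auto simp: cell_ok_def)
  have "addr s \<noteq> {}"
  proof (cases s)
    case (Loc p)
    then have "p \<in> \<Pi>" using cells_ok[OF assms] s(1) by (auto simp: cell_ok_def)
    then show ?thesis using addr_Loc Loc by (metis insert_not_empty)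
  qed (use s(2) in auto)
  then show ?thesis using s(1) by (auto simp: cell_preds_def)
qed

lemma card_NOT_preds:
  assumes "i < W" "fst (cs ! i) = NOT" shows "card (cell_preds i) = 1"
proof -
  obtain s where s: "snd (cs ! i) = {s}" "s \<notin> range Nbr"
    using cells_ok[OF assms(1)] assms(2) by (auto simp: cell_ok_def)
  show ?thesis
  proof (cases s)
    case (Loc p)
    then have "p \<in> \<Pi>" using cells_ok[OF assms(1)] s(1) by (auto simp: cell_ok_def)
    then obtain k where "addr (Loc p) = {k}" by (rule addr_Loc)
    then show ?thesis using s Loc by (simp add: cell_preds_def)
  qed (use s in \<open>auto simp: cell_preds_def\<close>)
qed

text \<open>Only output gates may have fan-out 0, so each input needs a reader;
  \<open>reads_all\<close> supplies it.\<close>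

lemma input_read:
  assumes "g < base" shows "\<exists>i<W. g \<in> cell_preds i"
proof -
  have "\<exists>s \<in> Loc ` \<Pi> \<union> Own ` {..<W} \<union> Nbr ` {..<W}. g \<in> addr s"
  proof -
    consider "g < card \<Pi>" | "card \<Pi> \<le> g" "g < card \<Pi> + W" | "card \<Pi> + W \<le> g" by linarith
    then show ?thesis
    proof cases
      case 1
      then have "sorted_list_of_set \<Pi> ! g \<in> \<Pi>"
        by (metis finite_props length_sorted_list_of_set nth_mem set_sorted_list_of_set)
      then show ?thesis using 1 by (intro bexI[of _ "Loc (sorted_list_of_set \<Pi> ! g)"]) auto
    next
      case 2
      then show ?thesis by (intro bexI[of _ "Own (g - card \<Pi>)"]) auto
    next
      case 3
      \<comment> \<open>Division of the offset by \<open>W\<close>: the quotient is the message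
        slot, the remainder the bit in it.\<close>
      define h where "h = g - card \<Pi> - W"
      have h: "h < \<Delta> * W" using assms 3 by (auto simp: h_def base_def algebra_simps)
      then have "W > 0" by (metis gr0I mult_0_right not_less0)
      moreover have "h div W < \<Delta>" using h by (simp add: less_mult_imp_div_less)
      moreover have "g = card \<Pi> + (W + (h div W * W + h mod W))" using 3 by (simp add: h_def)
      ultimately show ?thesis
        by (intro bexI[of _ "Nbr (h mod W)"])
          (simp only: addr.simps, blast, simp)
    qed
  qed
  then obtain s where "s \<in> (\<Union>i<W. snd (cs ! i))" "g \<in> addr s" using reads_all by blast
  then show ?thesis unfolding cell_preds_def by blast
qed

lemma wf_array_circuit: "wf_circuit array_circuit"
proof -
  have lt: "a < b \<and> b < base + 2 * W" if "(a, b) \<in> wires array_circuit" for a b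
    using that preds_less by (fastforce simp: array_circuit_def)
  have acyclic: "acyclic (wires array_circuit)"
    by (rule acyclic_subset[OF wf_acyclic[OF wf_less_than]]) (use lt in auto)
  have split: "g < base \<or> (\<exists>i<W. g = base + i) \<or> (\<exists>i<W. g = base + W + i)"
    if "g < base + 2 * W" for g
  proof -
    have "g < base \<or> (g - base < W \<and> g = base + (g - base))
        \<or> (g - (base + W) < W \<and> g = base + W + (g - (base + W)))"
      using that by linarith
    then show ?thesis by blast
  qed
  have ins: "set [0..<base] = {g \<in> {..<base + 2 * W}. preds array_circuit g = {}}"
    by (auto simp: preds_in preds_cell preds_out cell_preds_nonempty dest!: split)
  have outs: "set [base + W..<base + 2 * W] = {g \<in> {..<base + 2 * W}. succs array_circuit g = {}}"
  proof -
    have "succs array_circuit g = {}" if "base + W \<le> g" for g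
      using that by (auto simp: succs_def array_circuit_def dest!: preds_less[rotated])
    moreover have "succs array_circuit g \<noteq> {}" if g: "g < base + W" for g
    proof (cases "g < base")
      case True
      then show ?thesis using input_read by (fastforce simp: succs_def array_circuit_def)
    next
      case False
      then have "(g, base + W + (g - base)) \<in> wires array_circuit"
        using g by (auto simp: array_circuit_def intro!: exI[of _ "g - base"])
      then show ?thesis by (auto simp: succs_def)
    qed
    ultimately show ?thesis by (auto simp: not_le) (meson not_le)
  qed
  have lab: "gate_label array_circuit (base + i) = fst (cs ! i)" if "i < W" for i
    using that by (simp add: array_circuit_def)
  have NOTs: "card (preds array_circuit g) = 1"
    if "g < base + 2 * W" "preds array_circuit g \<noteq> {}" "gate_label array_circuit g = NOT" for g
    using split[OF that(1)] that(2,3) lab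
    by (auto simp: preds_in preds_cell preds_out card_NOT_preds)
  have simps: "gates array_circuit = {..<base + 2 * W}" "Defs.ins array_circuit = [0..<base]"
    "Defs.outs array_circuit = [base + W..<base + 2 * W]"
    by (simp_all add: array_circuit_def)
  have "wires array_circuit \<subseteq> {..<base + 2 * W} \<times> {..<base + 2 * W}"
    using lt by fastforce
  then show ?thesis
    unfolding wf_circuit_def simps by (intro conjI acyclic ins outs) (use NOTs in auto)
qed

lemma mpc_width_array [simp]: "mpc_width (array_mpc A Q) = W"
  by (simp add: mpc_width_def array_mpc_def array_circuit_def)

lemma circ_array [simp]: "circ (array_mpc A Q) = array_circuit"
  by (simp add: array_mpc_def)

lemma is_mpc_array: "A \<subseteq> {..<W} \<Longrightarrow> Q \<subseteq> {..<W} \<Longrightarrow> is_mpc \<Pi> \<Delta> (array_mpc A Q)"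
  unfolding is_mpc_def using wf_array_circuit
  by (simp only: mpc_width_array) (simp add: array_mpc_def array_circuit_def base_def)

lemma mpc_size_array: "mpc_size (array_mpc A Q) = card \<Pi> + W * (\<Delta> + 3)"
  by (simp add: mpc_size_def circuit_size_def array_mpc_def array_circuit_def base_def algebra_simps)

section \<open>Evaluation of the array circuit\<close>

lemma gate_value_in:
  assumes "length x = base" "g < base"
  shows "gate_value array_circuit x g = x ! g"
proof -
  have ins: "[0..<base] = ins array_circuit" by (simp add: array_circuit_def)
  have "map_of (zip [0..<base] x) g = Some (x ! g)"
    using assms by (subst map_of_eq_Some_iff) (auto simp: in_set_zip intro!: exI[of _ g])
  then show ?thesis
    using assms(2)
    by (subst gate_value_rec[OF wf_array_circuit])
      (simp add: gate_step_def preds_in ins[symmetric])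
qed

lemma gate_value_cell:
  assumes "i < W"
  shows "gate_value array_circuit x (base + i) =
    cell_value (\<lambda>s. \<exists>a\<in>addr s. gate_value array_circuit x a) (cs ! i)"
proof -
  let ?v = "gate_value array_circuit x"
  \<comment> \<open>AND and NOT quantify universally over predecessors, while a source is read
    existentially over its addresses. The two agree because without \<open>Nbr\<close> the address
    is unique.\<close>
  have uniq: "(\<forall>a\<in>addr s. P a) \<longleftrightarrow> (\<exists>a\<in>addr s. P a)"
    if "s \<in> snd (cs ! i)" "fst (cs ! i) \<noteq> OR" for s P
  proof (cases s)
    case (Loc p)
    then have "p \<in> \<Pi>" using cells_ok[OF assms] that by (auto simp: cell_ok_def)
    then obtain k where "addr (Loc p) = {k}" by (rule addr_Loc)
    then show ?thesis using Loc by (simp only:) simp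
  next
    case (Nbr j)
    then show ?thesis using cells_ok[OF assms] that by (auto simp: cell_ok_def)
  qed simp_all
  have lab: "gate_label array_circuit (base + i) = fst (cs ! i)"
    using assms by (simp add: array_circuit_def)
  have "?v (base + i) = (case fst (cs ! i) of
          AND \<Rightarrow> \<forall>h\<in>cell_preds i. ?v h
        | OR \<Rightarrow> \<exists>h\<in>cell_preds i. ?v h
        | NOT \<Rightarrow> \<forall>h\<in>cell_preds i. \<not> ?v h)"
    using cell_preds_nonempty[OF assms]
    by (subst gate_value_rec[OF wf_array_circuit])
      (simp only: gate_step_def preds_cell[OF assms] lab if_False)
  also have "\<dots> = cell_value (\<lambda>s. \<exists>a\<in>addr s. ?v a) (cs ! i)"
    using uniq by (cases "fst (cs ! i)") (auto simp: cell_value_def cell_preds_def)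
  finally show ?thesis .
qed

lemma circuit_output_nth:
  assumes "i < W"
  shows "circuit_output array_circuit x ! i = gate_value array_circuit x (base + i)"
proof -
  \<comment> \<open>An AND gate with a single predecessor is the identity.\<close>
  have lab: "gate_label array_circuit (base + W + i) = AND" by (simp add: array_circuit_def)
  have "circuit_output array_circuit x ! i = gate_value array_circuit x (base + W + i)"
    using assms by (simp add: circuit_output_def array_circuit_def)
  also have "\<dots> = gate_value array_circuit x (base + i)"
    using assms
    by (subst gate_value_rec[OF wf_array_circuit])
      (simp add: gate_step_def preds_out lab)
  finally show ?thesis .
qed

end

text \<open>Turns the circuit into a synchronous recurrence between cells, in which input strings no
  longer occur.\<close>

lemma (in cell_array) mpc_conf_array:
  fixes M :: "('w, 'p) kripke"
  assumes M: "M \<in> \<K> I \<Pi> \<Delta>" and w: "w \<in> worlds M" and i: "i < W"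
  shows "mpc_conf I \<Pi> \<Delta> (array_mpc A Q) M t w ! i =
    cell_value (src_value M (\<lambda>t w i. mpc_conf I \<Pi> \<Delta> (array_mpc A Q) M t w ! i) t w) (cs ! i)"
proof -
  let ?f = "mpc_conf I \<Pi> \<Delta> (array_mpc A Q) M"
  let ?ns = "neighbours I \<Pi> M w"
  \<comment> \<open>Merges both clauses of \<open>mpc_conf\<close>, so that round 0 and later rounds
    share one input string \<open>x\<close>.\<close>
  define tail where "tail = (case t of 0 \<Rightarrow> replicate (W * (\<Delta> + 1)) False
    | Suc t' \<Rightarrow> ?f t' w @ concat (map (?f t') ?ns) @ replicate (W * (\<Delta> - length ?ns)) False)"
  define x where "x = local_input \<Pi> M w @ tail"
  have ns: "set ?ns = successors M w" "length ?ns \<le> \<Delta>"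
  proof -
    have *: "set ?ns = successors M w" "distinct ?ns"
      using neighbours_sorted[OF M w] by (auto simp: distinct_map)
    then show "set ?ns = successors M w" "length ?ns \<le> \<Delta>"
      using M w distinct_card[OF *(2)] by (auto simp: \<K>_def)
  qed
  have len_f: "length (?f t' v) = W" for t' v
    by (simp add: length_mpc_conf)
  have len_loc: "length (local_input \<Pi> M w) = card \<Pi>" by (simp add: local_input_def)
  have len_cat: "length (concat (map (?f t') ?ns)) = length ?ns * W" for t'
    by (simp add: length_concat o_def len_f sum_list_triv)
  have "length tail = W * (\<Delta> + 1)"
  proof (cases t)
    case (Suc t')
    have "length ?ns * W + W * (\<Delta> - length ?ns) = W * \<Delta>"
      using ns(2) by (metis add_mult_distrib2 le_add_diff_inverse mult.commute)
    then show ?thesis using Suc by (simp add: tail_def len_f len_cat del: length_concat)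
  qed (simp add: tail_def)
  then have len_x: "length x = base" by (simp add: x_def len_loc base_def)
  have f_x: "?f t w = circuit_output array_circuit x"
    unfolding x_def tail_def by (cases t) simp_all
  have cell: "?f t w ! j = gate_value array_circuit x (base + j)" if "j < W" for j
    using circuit_output_nth[OF that] by (simp only: f_x)
  have own: "gate_value array_circuit x (card \<Pi> + j) = prev (\<lambda>t. ?f t w ! j) t" if "j < W" for j
  proof -
    have "card \<Pi> + j < base" using that by (simp add: base_def)
    then have "gate_value array_circuit x (card \<Pi> + j) = tail ! j"
      using gate_value_in[OF len_x] by (simp add: x_def nth_append len_loc)
    also have "\<dots> = prev (\<lambda>t. ?f t w ! j) t"
      using that by (cases t) (simp_all add: tail_def nth_append len_f trans_less_add1)
    finally show ?thesis .
  qed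
  have slot: "gate_value array_circuit x (card \<Pi> + (W + (s * W + j))) =
      prev (\<lambda>t. s < length ?ns \<and> ?f t (?ns ! s) ! j) t" if s: "s < \<Delta>" and j: "j < W" for s j
  proof -
    have b: "W + (s * W + j) < W * (\<Delta> + 1)" using slot_bound[OF s j] .
    then have "card \<Pi> + (W + (s * W + j)) < base" by (simp add: base_def)
    then have "gate_value array_circuit x (card \<Pi> + (W + (s * W + j))) = tail ! (W + (s * W + j))"
      using gate_value_in[OF len_x] by (simp add: x_def nth_append len_loc)
    also have "\<dots> = prev (\<lambda>t. s < length ?ns \<and> ?f t (?ns ! s) ! j) t"
    proof (cases t)
      case 0
      then show ?thesis using b by (simp add: tail_def)
    next
      case (Suc t')
      let ?r = "replicate (W * (\<Delta> - length ?ns)) False"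
      have "tail ! (W + (s * W + j)) = (concat (map (?f t') ?ns) @ ?r) ! (s * W + j)"
        using Suc by (simp add: tail_def nth_append len_f)
      also have "\<dots> = (s < length ?ns \<and> ?f t' (?ns ! s) ! j)"
      proof (cases "s < length ?ns")
        case True
        have "s * W + j < Suc s * W" "Suc s * W \<le> length ?ns * W"
          using True j by (auto intro: mult_le_mono1 simp del: mult_Suc) (simp add: mult.commute)
        then have "(concat (map (?f t') ?ns) @ ?r) ! (s * W + j) = concat (map (?f t') ?ns) ! (s * W + j)"
          by (simp add: nth_append len_cat del: length_concat)
        also have "\<dots> = concat (map (\<lambda>s. ?f t' (?ns ! s)) [0..<length ?ns]) ! (s * W + j)"
          by (rule arg_cong[where f = "\<lambda>xs. concat xs ! _"], rule nth_equalityI) simp_all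
        also have "\<dots> = ?f t' (?ns ! s) ! j"
          using nth_concat_upt[of s "length ?ns" j "\<lambda>s. ?f t' (?ns ! s)"] True j by (simp add: len_f)
        finally show ?thesis using True by simp
      next
        case False
        then have "length ?ns * W \<le> s * W + j" by (simp add: mult_le_mono1 trans_le_add1)
        moreover have "s * W + j - length ?ns * W < W * (\<Delta> - length ?ns)"
        proof -
          have "s * W + j < \<Delta> * W" using b by (simp add: algebra_simps)
          then show ?thesis using calculation by (simp add: diff_mult_distrib2 algebra_simps)
        qed
        ultimately show ?thesis using False by (simp add: nth_append len_cat del: length_concat)
      qed
      finally show ?thesis using Suc by simp
    qed
    finally show ?thesis .
  qed
  have src: "(\<exists>a\<in>addr s. gate_value array_circuit x a) =
      src_value M (\<lambda>t w i. ?f t w ! i) t w s" if s: "s \<in> snd (cs ! i)" for s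
  proof (cases s)
    case (Loc p)
    then have "p \<in> \<Pi>" using cells_ok[OF i] s by (auto simp: cell_ok_def)
    then obtain k where k: "k < card \<Pi>" "sorted_list_of_set \<Pi> ! k = p" "addr (Loc p) = {k}"
      by (rule addr_Loc)
    have "gate_value array_circuit x k = (w \<in> val M p)"
      using gate_value_in[OF len_x, of k] k(1,2)
      by (simp add: x_def nth_append len_loc base_def) (simp add: local_input_def)
    then show ?thesis unfolding Loc k(3) by simp
  next
    case (Own j)
    then have "j < W" using cells_ok[OF i] s by (auto simp: cell_ok_def)
    then show ?thesis using Own own by simp
  next
    case (Nbr j)
    then have j: "j < W" using cells_ok[OF i] s by (auto simp: cell_ok_def)
    have "(\<exists>a\<in>addr s. gate_value array_circuit x a) =
        (\<exists>s<\<Delta>. prev (\<lambda>t. s < length ?ns \<and> ?f t (?ns ! s) ! j) t)"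
      using slot[OF _ j] by (auto simp: Nbr)
    \<comment> \<open>Padding is neutral for disjunction, so the out-degree and the order of the
      neighbours are immaterial.\<close>
    also have "\<dots> = prev (\<lambda>t. \<exists>v\<in>set ?ns. ?f t v ! j) t"
    proof (cases t)
      case (Suc t')
      have "(\<exists>s<\<Delta>. s < length ?ns \<and> ?f t' (?ns ! s) ! j) \<longleftrightarrow> (\<exists>s<length ?ns. ?f t' (?ns ! s) ! j)"
        using ns(2) by (meson order_less_le_trans)
      then show ?thesis using Suc by (simp add: set_conv_nth) metis
    qed simp
    finally show ?thesis by (simp add: Nbr ns(1))
  next
    case (Cur j)
    then have "j < W" using cells_ok[OF i] s i by (auto simp: cell_ok_def)
    then show ?thesis using Cur cell by simp
  qed
  show ?thesis
    unfolding cell[OF i] gate_value_cell[OF i] cell_value_def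
    using src by (cases "fst (cs ! i)") simp_all
qed

section \<open>Systems of delayed schemata\<close>

text \<open>A round of a message passing circuit only sees the states of the previous round. Hence both
  schema variables and the argument of a diamond refer to the previous round below, and a schema of
  modal depth \<open>d\<close> gets its proper value only after the variables were constant for \<open>d\<close> rounds.\<close>

primrec delayed ::
  "('w, 'p) kripke \<Rightarrow> (nat \<Rightarrow> 'w \<Rightarrow> nat \<Rightarrow> bool) \<Rightarrow> 'p schema \<Rightarrow> nat \<Rightarrow> 'w \<Rightarrow> bool" where
  "delayed M R STop t w \<longleftrightarrow> True"
| "delayed M R (SProp p) t w \<longleftrightarrow> w \<in> val M p"
| "delayed M R (SVar j) t w \<longleftrightarrow> prev (\<lambda>t. R t w j) t"
| "delayed M R (SNeg \<phi>) t w \<longleftrightarrow> \<not> delayed M R \<phi> t w"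
| "delayed M R (SConj \<phi> \<psi>) t w \<longleftrightarrow> delayed M R \<phi> t w \<and> delayed M R \<psi> t w"
| "delayed M R (SDia \<phi>) t w \<longleftrightarrow> prev (\<lambda>t. \<exists>v\<in>successors M w. delayed M R \<phi> t v) t"

text \<open>The window of constant variables starts at \<open>t\<close>. A diamond asks its
  successors one round earlier in the same window, so \<open>r\<close> drops with the depth while
  \<open>t\<close> stays; shallower subschemata need no synchronisation, since \<open>r\<close> only
  bounds the depth.\<close>

lemma delayed_sat:
  assumes "acc M \<subseteq> worlds M \<times> worlds M" "w \<in> worlds M" "schema_depth \<phi> \<le> r"
    and "\<And>s v j. s \<le> r \<Longrightarrow> v \<in> worlds M \<Longrightarrow> j \<in> schema_vars \<phi> \<Longrightarrow>
      prev (\<lambda>t. R t v j) (t + s) = sat M v (\<sigma> j)"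
  shows "delayed M R \<phi> (t + r) w = sat M w (inst \<sigma> \<phi>)"
  using assms(2-)
proof (induction \<phi> arbitrary: r w)
  case (SDia \<phi>)
  obtain r' where r: "r = Suc r'" "schema_depth \<phi> \<le> r'" using SDia.prems(2) by (cases r) auto
  have "delayed M R \<phi> (t + r') v = sat M v (inst \<sigma> \<phi>)" if "(w, v) \<in> acc M" for v
    using that assms(1) r SDia.prems(3) by (intro SDia.IH) auto
  then show ?case using r(1) by (auto simp: successors_def)
qed auto

text \<open>Postorder layout from cell \<open>a\<close> on, so the root is the last cell of its
  block; \<open>f\<close> locates the register of a variable. \<open>Cur 3\<close>, the constant
  false, is neutral in the disjunction and keeps its fan-in nonzero when there are no message
  slots.\<close>

primrec compile :: "(nat \<Rightarrow> nat) \<Rightarrow> nat \<Rightarrow> 'p schema \<Rightarrow> 'p cell list" where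
  "compile f a STop = [(OR, {Cur 2})]"
| "compile f a (SProp p) = [(OR, {Loc p})]"
| "compile f a (SVar j) = [(OR, {Own (f j)})]"
| "compile f a (SNeg \<phi>) = compile f a \<phi> @ [(NOT, {Cur (a + schema_size \<phi> - 1)})]"
| "compile f a (SConj \<phi> \<psi>) = compile f a \<phi> @ compile f (a + schema_size \<phi>) \<psi> @
     [(AND, {Cur (a + schema_size \<phi> - 1), Cur (a + schema_size \<phi> + schema_size \<psi> - 1)})]"
| "compile f a (SDia \<phi>) = compile f a \<phi> @ [(OR, {Cur 3, Nbr (a + schema_size \<phi> - 1)})]"

lemma length_compile [simp]: "length (compile f a \<phi>) = schema_size \<phi>"
  by (induction \<phi> arbitrary: a) auto

lemma schema_size_pos: "0 < schema_size \<phi>"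
  by (cases \<phi>) auto

lemma compile_ok:
  assumes "schema_props \<phi> \<subseteq> \<Pi>" "\<And>j. j \<in> schema_vars \<phi> \<Longrightarrow> f j < W" "4 \<le> a"
    "a + schema_size \<phi> \<le> W" "i < schema_size \<phi>"
  shows "cell_ok \<Pi> W (a + i) (compile f a \<phi> ! i)"
  using assms
proof (induction \<phi> arbitrary: a i)
  case (SNeg \<phi>)
  show ?case
  proof (cases "i < schema_size \<phi>")
    case True
    then show ?thesis using SNeg.IH[of a i] SNeg.prems by (simp add: nth_append)
  next
    case False
    then have "i = schema_size \<phi>" using SNeg.prems by simp
    then show ?thesis using schema_size_pos[of \<phi>] by (auto simp: cell_ok_def nth_append)
  qed
next
  case (SDia \<phi>)
  show ?case
  proof (cases "i < schema_size \<phi>")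
    case True
    then show ?thesis using SDia.IH[of a i] SDia.prems by (simp add: nth_append)
  next
    case False
    then have "i = schema_size \<phi>" using SDia.prems by simp
    then show ?thesis using SDia.prems by (auto simp: cell_ok_def nth_append)
  qed
next
  case (SConj \<phi> \<psi>)
  consider "i < schema_size \<phi>" | l where "i = schema_size \<phi> + l" "l < schema_size \<psi>"
    | "i = schema_size \<phi> + schema_size \<psi>"
  proof -
    have "i < schema_size \<phi> \<or> i = schema_size \<phi> + (i - schema_size \<phi>) \<and> i - schema_size \<phi> < schema_size \<psi>
        \<or> i = schema_size \<phi> + schema_size \<psi>"
      using SConj.prems(5) by (simp, linarith)
    then show ?thesis using that by blast
  qed
  then show ?case
  proof cases
    case 1
    then show ?thesis using SConj.IH(1)[of a i] SConj.prems by (simp add: nth_append)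
  next
    case 2
    then show ?thesis
      using SConj.IH(2)[of "a + schema_size \<phi>" l] SConj.prems by (simp add: nth_append add.assoc)
  next
    case 3
    then show ?thesis
      using schema_size_pos[of \<phi>] schema_size_pos[of \<psi>] by (auto simp: cell_ok_def nth_append)
  qed
qed (auto simp: cell_ok_def)

text \<open>No induction on time: \<open>delayed\<close> reads the variables from the same run
  \<open>V\<close>, so structural induction, for all rounds and worlds at once, suffices.\<close>

lemma compile_correct:
  assumes acc: "acc M \<subseteq> worlds M \<times> worlds M"
    and V: "\<And>t w i. w \<in> worlds M \<Longrightarrow> i < length cs \<Longrightarrow>
      V t w i = cell_value (src_value M V t w) (cs ! i)"
    and const: "\<And>t w. w \<in> worlds M \<Longrightarrow> V t w 2" "\<And>t w. w \<in> worlds M \<Longrightarrow> \<not> V t w 3"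
    and "w \<in> worlds M" "a + schema_size \<phi> \<le> length cs"
    and "\<And>i. i < schema_size \<phi> \<Longrightarrow> cs ! (a + i) = compile f a \<phi> ! i"
  shows "V t w (a + schema_size \<phi> - 1) = delayed M (\<lambda>t w j. V t w (f j)) \<phi> t w"
  using assms(5-)
proof (induction \<phi> arbitrary: a t w)
  case (SNeg \<phi>)
  have "V t w (a + schema_size \<phi> - 1) = delayed M (\<lambda>t w j. V t w (f j)) \<phi> t w"
    using SNeg.prems(1,2) SNeg.prems(3) by (intro SNeg.IH) (force simp: nth_append)+
  moreover have "cs ! (a + schema_size \<phi>) = (NOT, {Cur (a + schema_size \<phi> - 1)})"
    using SNeg.prems(3)[of "schema_size \<phi>"] by (simp add: nth_append)
  ultimately show ?case
    using V[OF SNeg.prems(1), of "a + schema_size \<phi>"] SNeg.prems(2) by (simp add: cell_value_def)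
next
  case (SDia \<phi>)
  have "V t' v (a + schema_size \<phi> - 1) = delayed M (\<lambda>t w j. V t w (f j)) \<phi> t' v"
    if "v \<in> worlds M" for t' v
    using that SDia.prems(2) SDia.prems(3) by (intro SDia.IH) (force simp: nth_append)+
  moreover have "successors M w \<subseteq> worlds M" using acc by (auto simp: successors_def)
  moreover have "cs ! (a + schema_size \<phi>) = (OR, {Cur 3, Nbr (a + schema_size \<phi> - 1)})"
    using SDia.prems(3)[of "schema_size \<phi>"] by (simp add: nth_append)
  ultimately show ?case
    using V[OF SDia.prems(1), of "a + schema_size \<phi>"] SDia.prems(2) const(2)[OF SDia.prems(1)]
    by (cases t) (auto simp: cell_value_def)
next
  case (SConj \<phi> \<psi>)
  have cs1: "cs ! (a + i) = compile f a \<phi> ! i" if "i < schema_size \<phi>" for i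
    using SConj.prems(3)[of i] that by (simp add: nth_append)
  have cs2: "cs ! (a + schema_size \<phi> + i) = compile f (a + schema_size \<phi>) \<psi> ! i"
    if "i < schema_size \<psi>" for i
    using SConj.prems(3)[of "schema_size \<phi> + i"] that by (simp add: nth_append add.assoc)
  have cs3: "cs ! (a + schema_size \<phi> + schema_size \<psi>) =
      (AND, {Cur (a + schema_size \<phi> - 1), Cur (a + schema_size \<phi> + schema_size \<psi> - 1)})"
    using SConj.prems(3)[of "schema_size \<phi> + schema_size \<psi>"] by (simp add: nth_append add.assoc)
  show ?case
    using V[OF SConj.prems(1), of "a + schema_size \<phi> + schema_size \<psi>" t]
      SConj.IH(1)[OF SConj.prems(1) _ cs1, of t] SConj.IH(2)[OF SConj.prems(1) _ cs2, of t]
      SConj.prems(2) cs3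
    by (simp add: cell_value_def add.assoc)
qed (use V const(1) in \<open>fastforce simp: cell_value_def\<close>)+

text \<open>The prelude consists of a cell that reads every input (so that all inputs have nonzero
  fan-out), its negation, and the constants true (cell 2) and false (cell 3).\<close>

definition prelude :: "'p set \<Rightarrow> nat \<Rightarrow> 'p cell list" where
  "prelude \<Pi> W = [(OR, Loc ` \<Pi> \<union> Own ` {..<W} \<union> Nbr ` {..<W}), (NOT, {Cur 0}),
     (OR, {Cur 0, Cur 1}), (AND, {Cur 0, Cur 1})]"

definition start :: "'p schema list \<Rightarrow> nat \<Rightarrow> nat" where
  "start us j = 4 + (\<Sum>i<j. schema_size (us ! i))"

text \<open>A variable has no register apart from the root cell of its own update; reading that cell
  with \<open>Own\<close> gives the value of the previous round.\<close>

definition root :: "'p schema list \<Rightarrow> nat \<Rightarrow> nat" where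
  "root us j = start us j + schema_size (us ! j) - 1"

definition system_cells :: "'p set \<Rightarrow> 'p schema list \<Rightarrow> 'p cell list" where
  "system_cells \<Pi> us = prelude \<Pi> (start us (length us)) @
     concat (map (\<lambda>j. compile (root us) (start us j) (us ! j)) [0..<length us])"

lemma start_Suc: "start us (Suc j) = start us j + schema_size (us ! j)"
  by (simp add: start_def)

lemma start_mono: "i \<le> j \<Longrightarrow> start us i \<le> start us j"
  by (rule lift_Suc_mono_le[of "start us"]) (simp_all add: start_Suc)

lemma root_less_start: "i < j \<Longrightarrow> root us i < start us j"
  using start_mono[of "Suc i" j us] schema_size_pos[of "us ! i"] by (simp add: root_def start_Suc)

text \<open>Moving the heads to root cells preserves their order, hence the order of the printed
  bits.\<close>

lemma strict_mono_root: "strict_mono (root us)"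
proof
  fix i j :: nat assume "i < j"
  then show "root us i < root us j"
    using root_less_start[of i j us] schema_size_pos[of "us ! j"] by (simp add: root_def)
qed

lemma length_system_cells: "length (system_cells \<Pi> us) = start us (length us)"
  by (simp add: system_cells_def prelude_def start_def length_concat_upt del: length_concat)

lemma system_cells_prelude: "i < 4 \<Longrightarrow> system_cells \<Pi> us ! i = prelude \<Pi> (start us (length us)) ! i"
  by (simp add: system_cells_def nth_append) (simp add: prelude_def)

lemma system_cells_block:
  assumes "j < length us" "i < schema_size (us ! j)"
  shows "system_cells \<Pi> us ! (start us j + i) = compile (root us) (start us j) (us ! j) ! i"
  using nth_concat_upt[OF assms(1), of i "\<lambda>j. compile (root us) (start us j) (us ! j)"] assms(2)
  by (simp add: system_cells_def nth_append prelude_def start_def)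

lemma system_cells_index:
  assumes "i < start us n"
  shows "i < 4 \<or> (\<exists>j<n. \<exists>l<schema_size (us ! j). i = start us j + l)"
  using assms
proof (induction n)
  case (Suc n)
  show ?case
  proof (cases "i < start us n")
    case False
    then have "i = start us n + (i - start us n)" "i - start us n < schema_size (us ! n)"
      using Suc.prems by (auto simp: start_Suc)
    then show ?thesis by blast
  qed (use Suc.IH less_SucI in blast)
qed (simp add: start_def)

lemma cell_array_system:
  fixes \<Pi> :: "'p::linorder set"
  assumes "finite \<Pi>"
    and us: "\<And>j. j < length us \<Longrightarrow> schema_props (us ! j) \<subseteq> \<Pi> \<and> schema_vars (us ! j) \<subseteq> {..<length us}"
  shows "cell_array \<Pi> (system_cells \<Pi> us)"
proof
  let ?W = "start us (length us)"
  have four: "4 \<le> start us j" for j by (simp add: start_def)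
  show "cell_ok \<Pi> (length (system_cells \<Pi> us)) i (system_cells \<Pi> us ! i)"
    if i: "i < length (system_cells \<Pi> us)" for i
  proof -
    consider "i < 4" | j l where "j < length us" "l < schema_size (us ! j)" "i = start us j + l"
      using system_cells_index[of i us "length us"] i by (auto simp: length_system_cells)
    then show ?thesis
    proof cases
      case 1
      then have "i = 0 \<or> i = 1 \<or> i = 2 \<or> i = 3" by linarith
      moreover have "0 < ?W" using four[of "length us"] by linarith
      \<comment> \<open>The state is never empty, so cell 0 has a source besides \<open>Nbr\<close>
        even if \<Pi> is empty.\<close>
      moreover have "\<exists>s\<in>Loc ` \<Pi> \<union> Own ` {..<?W} \<union> Nbr ` {..<?W}. s \<notin> range Nbr"
        using \<open>0 < ?W\<close> by (intro bexI[of _ "Own 0"]) auto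
      ultimately show ?thesis
        using system_cells_prelude[OF 1, of \<Pi> us]
        by (auto simp: cell_ok_def prelude_def length_system_cells numeral_3_eq_3 numeral_2_eq_2)
    next
      case 2
      have "start us j + schema_size (us ! j) \<le> ?W"
        using start_mono[of "Suc j" "length us" us] 2(1) by (simp add: start_Suc)
      moreover have "root us m < ?W" if "m \<in> schema_vars (us ! j)" for m
        using that us[OF 2(1)] by (intro root_less_start) auto
      ultimately show ?thesis
        using 2 us[OF 2(1)] four system_cells_block[OF 2(1,2), of \<Pi>]
        by (auto simp: length_system_cells intro!: compile_ok)
    qed
  qed
  have "0 < ?W" using four[of "length us"] by linarith
  moreover have "snd (system_cells \<Pi> us ! 0) = Loc ` \<Pi> \<union> Own ` {..<?W} \<union> Nbr ` {..<?W}"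
    using system_cells_prelude[of 0 \<Pi> us] by (simp add: prelude_def)
  ultimately show "Loc ` \<Pi> \<union> Own ` {..<length (system_cells \<Pi> us)} \<union> Nbr ` {..<length (system_cells \<Pi> us)}
      \<subseteq> (\<Union>i<length (system_cells \<Pi> us). snd (system_cells \<Pi> us ! i))"
    unfolding length_system_cells by blast
qed (rule assms)

text \<open>The interface to the circuits: their behaviour enters the simulation only through these
  equations.\<close>

lemma system_conf:
  fixes \<Pi> :: "'p::linorder set" and M :: "('w, 'p) kripke" and A Q :: "nat set"
  assumes "finite \<Pi>"
    and us: "\<And>j. j < length us \<Longrightarrow> schema_props (us ! j) \<subseteq> \<Pi> \<and> schema_vars (us ! j) \<subseteq> {..<length us}"
    and M: "M \<in> \<K> I \<Pi> \<Delta>" and w: "w \<in> worlds M" and j: "j < length us"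
  defines "V \<equiv> \<lambda>t w i. mpc_conf I \<Pi> \<Delta> (cell_array.array_mpc \<Pi> \<Delta> (system_cells \<Pi> us) A Q) M t w ! i"
  shows "V t w (root us j) = delayed M (\<lambda>t w j. V t w (root us j)) (us ! j) t w"
proof -
  interpret cell_array \<Pi> \<Delta> "system_cells \<Pi> us"
    using assms(1) us by (rule cell_array_system)
  have V: "V t w i = cell_value (src_value M V t w) (system_cells \<Pi> us ! i)"
    if "w \<in> worlds M" "i < start us (length us)" for t w i
    using mpc_conf_array[OF M that(1)] that(2) by (simp add: V_def length_system_cells)
  have le: "start us j + schema_size (us ! j) \<le> start us (length us)"
    using start_mono[of "Suc j" "length us" us] j by (simp add: start_Suc)
  have pre: "V t w i = cell_value (src_value M V t w) (prelude \<Pi> (start us (length us)) ! i)"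
    if "w \<in> worlds M" "i < 4" for t w i
  proof -
    have "i < start us (length us)" using that(2) by (simp add: start_def)
    then show ?thesis using V[OF that(1)] system_cells_prelude[OF that(2)] by metis
  qed
  \<comment> \<open>Cells 2 and 3 are excluded middle and contradiction over cell 0, whatever that
    cell reads.\<close>
  have V1: "V t w 1 \<longleftrightarrow> \<not> V t w 0" if "w \<in> worlds M" for t w
    using pre[OF that, of 1 t] by (simp add: prelude_def cell_value_def)
  have "V t w 2" if "w \<in> worlds M" for t w
    using pre[OF that, of 2 t] V1[OF that, of t] by (simp add: prelude_def cell_value_def)
  moreover have "\<not> V t w 3" if "w \<in> worlds M" for t w
    using pre[OF that, of 3 t] V1[OF that, of t] by (simp add: prelude_def cell_value_def)
  moreover have "acc M \<subseteq> worlds M \<times> worlds M" using M by (simp add: \<K>_def kripke_over_def)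
  ultimately show ?thesis
    unfolding root_def[of us j] using V le system_cells_block[OF j] w
    by (intro compile_correct[where cs = "system_cells \<Pi> us"]) (simp_all add: length_system_cells)
qed

section \<open>Simulating a program\<close>

text \<open>Terminal bodies become schemata without variables, so one compiler serves both kinds of
  clause.\<close>

primrec schema_of :: "'p fml \<Rightarrow> 'p schema" where
  "schema_of Top = STop"
| "schema_of (Prop p) = SProp p"
| "schema_of (Neg \<phi>) = SNeg (schema_of \<phi>)"
| "schema_of (Conj \<phi> \<psi>) = SConj (schema_of \<phi>) (schema_of \<psi>)"
| "schema_of (Dia \<phi>) = SDia (schema_of \<phi>)"

lemma schema_of_simps [simp]:
  "schema_vars (schema_of \<phi>) = {}" "schema_props (schema_of \<phi>) = fml_props \<phi>"
  "inst \<sigma> (schema_of \<phi>) = \<phi>" "schema_size (schema_of \<phi>) = fml_size \<phi>"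
  "schema_depth (schema_of \<phi>) = fml_depth \<phi>"
  by (induction \<phi>) auto

text \<open>Only the test is duplicated. All tests used below have size 1, so the size stays
  linear.\<close>

definition SIte :: "'p schema \<Rightarrow> 'p schema \<Rightarrow> 'p schema \<Rightarrow> 'p schema" where
  "SIte \<chi> \<phi> \<psi> = SNeg (SConj (SNeg (SConj \<chi> \<phi>)) (SNeg (SConj (SNeg \<chi>) \<psi>)))"

lemma SIte_simps [simp]:
  "delayed M R (SIte \<chi> \<phi> \<psi>) t w = (if delayed M R \<chi> t w then delayed M R \<phi> t w else delayed M R \<psi> t w)"
  "schema_vars (SIte \<chi> \<phi> \<psi>) = schema_vars \<chi> \<union> schema_vars \<phi> \<union> schema_vars \<psi>"
  "schema_props (SIte \<chi> \<phi> \<psi>) = schema_props \<chi> \<union> schema_props \<phi> \<union> schema_props \<psi>"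
  "schema_size (SIte \<chi> \<phi> \<psi>) = 7 + 2 * schema_size \<chi> + schema_size \<phi> + schema_size \<psi>"
  by (auto simp: SIte_def)

text \<open>The clock is a counter modulo \<open>d + 1\<close> in unary, where \<open>d\<close> is the modal depth:
  \<open>clock_ge \<Lambda> j\<close> states that round \<open>t\<close> satisfies \<open>j \<le> t mod (d + 1)\<close>. It is false at all
  positive \<open>j\<close> in round 0, as needed, because the initial messages are zero. The last
  register records whether a round \<open>\<ge> d\<close> has passed.\<close>

definition clock_ge :: "'p program \<Rightarrow> nat \<Rightarrow> 'p schema" where
  "clock_ge \<Lambda> j = (if j = 0 then STop else SVar (heads \<Lambda> + j - 1))"

abbreviation "tick \<Lambda> \<equiv> clock_ge \<Lambda> (modal_depth \<Lambda>)"

abbreviation loaded :: "'p program \<Rightarrow> 'p schema" where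
  "loaded \<Lambda> \<equiv> SVar (heads \<Lambda> + modal_depth \<Lambda>)"

text \<open>Registers are read one round late, so at the first tick \<open>loaded\<close> is still
  false and the terminal body is chosen; every later tick chooses the iteration body.\<close>

definition updates :: "'p program \<Rightarrow> 'p schema list" where
  "updates \<Lambda> =
     map (\<lambda>i. SIte (tick \<Lambda>)
       (SIte (loaded \<Lambda>) (iter_bodies \<Lambda> ! i) (schema_of (term_bodies \<Lambda> ! i))) (SVar i)) [0..<heads \<Lambda>] @
     map (\<lambda>j. SConj (SNeg (tick \<Lambda>)) (clock_ge \<Lambda> j)) [0..<modal_depth \<Lambda>] @
     [SNeg (SConj (SNeg (tick \<Lambda>)) (SNeg (loaded \<Lambda>)))]"

lemma length_updates [simp]: "length (updates \<Lambda>) = heads \<Lambda> + modal_depth \<Lambda> + 1"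
  by (simp add: updates_def)

lemma updates_nth:
  "i < heads \<Lambda> \<Longrightarrow> updates \<Lambda> ! i = SIte (tick \<Lambda>)
     (SIte (loaded \<Lambda>) (iter_bodies \<Lambda> ! i) (schema_of (term_bodies \<Lambda> ! i))) (SVar i)"
  "j < modal_depth \<Lambda> \<Longrightarrow>
     updates \<Lambda> ! (heads \<Lambda> + j) = SConj (SNeg (tick \<Lambda>)) (clock_ge \<Lambda> j)"
  "updates \<Lambda> ! (heads \<Lambda> + modal_depth \<Lambda>) = SNeg (SConj (SNeg (tick \<Lambda>)) (SNeg (loaded \<Lambda>)))"
  by (simp_all add: updates_def nth_append)

lemma program_body:
  assumes "is_program \<Pi> \<Lambda>" "i < heads \<Lambda>"
  shows "fml_props (term_bodies \<Lambda> ! i) \<subseteq> \<Pi>" "schema_props (iter_bodies \<Lambda> ! i) \<subseteq> \<Pi>"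
    "schema_vars (iter_bodies \<Lambda> ! i) \<subseteq> {..<heads \<Lambda>}"
    "fml_depth (term_bodies \<Lambda> ! i) \<le> modal_depth \<Lambda>" "schema_depth (iter_bodies \<Lambda> ! i) \<le> modal_depth \<Lambda>"
proof -
  have "term_bodies \<Lambda> ! i \<in> set (term_bodies \<Lambda>)" "iter_bodies \<Lambda> ! i \<in> set (iter_bodies \<Lambda>)"
    using assms by (simp_all add: is_program_def heads_def)
  then show "fml_props (term_bodies \<Lambda> ! i) \<subseteq> \<Pi>" "schema_props (iter_bodies \<Lambda> ! i) \<subseteq> \<Pi>"
    "schema_vars (iter_bodies \<Lambda> ! i) \<subseteq> {..<heads \<Lambda>}"
    "fml_depth (term_bodies \<Lambda> ! i) \<le> modal_depth \<Lambda>" "schema_depth (iter_bodies \<Lambda> ! i) \<le> modal_depth \<Lambda>"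
    using assms(1) by (auto simp: is_program_def modal_depth_def)
qed

lemma updates_wf:
  assumes "is_program \<Pi> \<Lambda>" "j < length (updates \<Lambda>)"
  shows "schema_props (updates \<Lambda> ! j) \<subseteq> \<Pi> \<and> schema_vars (updates \<Lambda> ! j) \<subseteq> {..<length (updates \<Lambda>)}"
proof -
  consider "j < heads \<Lambda>" | l where "l < modal_depth \<Lambda>" "j = heads \<Lambda> + l" | "j = heads \<Lambda> + modal_depth \<Lambda>"
  proof -
    have "j < heads \<Lambda> \<or> j - heads \<Lambda> < modal_depth \<Lambda> \<and> j = heads \<Lambda> + (j - heads \<Lambda>)
        \<or> j = heads \<Lambda> + modal_depth \<Lambda>"
      using assms(2) by simp linarith
    then show ?thesis using that by blast
  qed
  then show ?thesis
  proof cases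
    case 1
    then show ?thesis
      using program_body[OF assms(1) 1] by (force simp: updates_nth clock_ge_def)
  qed (auto simp: updates_nth clock_ge_def)
qed

text \<open>Abstracts from circuits: \<open>R\<close> is any solution of the update
  equations.\<close>

locale simulation =
  fixes \<Pi> :: "'p set" and \<Lambda> :: "'p program" and M :: "('w, 'p) kripke"
    and R :: "nat \<Rightarrow> 'w \<Rightarrow> nat \<Rightarrow> bool"
  assumes program: "is_program \<Pi> \<Lambda>"
    and acc: "acc M \<subseteq> worlds M \<times> worlds M"
    and run: "w \<in> worlds M \<Longrightarrow> j < length (updates \<Lambda>) \<Longrightarrow> R t w j = delayed M R (updates \<Lambda> ! j) t w"
begin

abbreviation "d \<equiv> modal_depth \<Lambda>"
abbreviation "T \<equiv> Suc d"

text \<open>Stated through \<open>prev\<close>, as the register is seen by its readers; round 0 then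
  holds by the default \<open>False\<close>.\<close>

lemma clock_register:
  assumes "w \<in> worlds M" "j < d"
  shows "prev (\<lambda>t. R t w (heads \<Lambda> + j)) t \<longleftrightarrow> j < t mod T"
  using assms(2)
proof (induction t arbitrary: j)
  case (Suc t)
  have ge: "delayed M R (clock_ge \<Lambda> l) t w \<longleftrightarrow> l \<le> t mod T" if "l \<le> d" for l
    using Suc.IH[of "l - 1"] that by (cases l) (auto simp: clock_ge_def)
  \<comment> \<open>The two branches of \<open>mod_Suc\<close>: the clock wraps exactly when it
    stands at \<open>d\<close>.\<close>
  have "j < (if Suc m = T then 0 else Suc m) \<longleftrightarrow> \<not> d \<le> m \<and> j \<le> m" if "m \<le> d" for m
    using that by auto
  moreover have "t mod T \<le> d" using mod_less_divisor[of T t] by linarith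
  ultimately have "j < Suc t mod T \<longleftrightarrow> \<not> d \<le> t mod T \<and> j \<le> t mod T"
    unfolding mod_Suc by blast
  then show ?case
    using run[OF assms(1), of "heads \<Lambda> + j" t] Suc.prems ge[of d] ge[of j] by (simp add: updates_nth)
qed simp

lemma clock:
  assumes "w \<in> worlds M" "j \<le> d"
  shows "delayed M R (clock_ge \<Lambda> j) t w \<longleftrightarrow> j \<le> t mod T"
  using clock_register[OF assms(1), of "j - 1" t] assms(2) by (cases j) (auto simp: clock_ge_def)

lemma tick:
  assumes "w \<in> worlds M" "r \<le> d"
  shows "delayed M R (tick \<Lambda>) (q * T + r) w \<longleftrightarrow> r = d"
proof -
  have "(q * T + r) mod T = r" using assms(2) by (simp add: mod_mult_self3 del: mult_Suc_right)
  then show ?thesis using clock[OF assms(1) order_refl, of "q * T + r"] assms(2) by auto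
qed

lemma loaded:
  assumes "w \<in> worlds M"
  shows "delayed M R (loaded \<Lambda>) t w \<longleftrightarrow> T \<le> t"
proof (induction t)
  case (Suc t)
  \<comment> \<open>In the first period only round \<open>d\<close> ticks; afterwards the flag
    sustains itself.\<close>
  have "delayed M R (tick \<Lambda>) t w \<or> T \<le> t \<longleftrightarrow> d \<le> t"
    using clock[OF assms order_refl, of t] mod_less_eq_dividend[of t T]
    by (auto dest: order_trans)
  then show ?case
    using run[OF assms, of "heads \<Lambda> + d" t] Suc by (simp add: updates_nth)
qed simp

text \<open>Provides the window of constant variables that \<open>delayed_sat\<close> asks
  for.\<close>

lemma head_hold:
  assumes "w \<in> worlds M" "i < heads \<Lambda>" "r \<le> d"
  shows "prev (\<lambda>t. R t w i) (q * T + r) = prev (\<lambda>t. R t w i) (q * T)"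
  using assms(3)
proof (induction r)
  case (Suc r)
  then have "\<not> delayed M R (tick \<Lambda>) (q * T + r) w" using tick[OF assms(1)] by simp
  then have "R (q * T + r) w i = prev (\<lambda>t. R t w i) (q * T + r)"
    using run[OF assms(1), of i "q * T + r"] assms(2) by (simp add: updates_nth del: mult_Suc_right)
  then show ?case using Suc by (simp del: mult_Suc_right)
qed simp

lemma head_load:
  assumes "w \<in> worlds M" "i < heads \<Lambda>"
  shows "R (q * T + d) w i = sat M w (iter_fml \<Lambda> q i)"
  using assms
proof (induction q arbitrary: w i)
  case 0
  \<comment> \<open>Without variables the window condition is vacuous, so the substitution is
    arbitrary and the window may start in round 0.\<close>
  have "delayed M R (schema_of (term_bodies \<Lambda> ! i)) (0 + d) w = sat M w (inst undefined (schema_of (term_bodies \<Lambda> ! i)))"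
    by (rule delayed_sat[OF acc 0(1)]) (use program_body[OF program 0(2)] in simp_all)
  moreover have "R d w i = delayed M R (schema_of (term_bodies \<Lambda> ! i)) d w"
    using run[OF 0(1), of i d] 0(2) tick[OF 0(1), of d 0] loaded[OF 0(1), of d]
    by (simp add: updates_nth)
  ultimately show ?case by simp
next
  case (Suc q)
  let ?t = "Suc q * T"
  have "prev (\<lambda>t. R t v j) (?t + r) = sat M v (iter_fml \<Lambda> q j)"
    if "v \<in> worlds M" "j < heads \<Lambda>" "r \<le> d" for v j r
  proof -
    \<comment> \<open>The tick of period \<open>q\<close> is the round just before
      \<open>?t\<close>, so the new window opens on the freshly loaded values.\<close>
    have "?t = Suc (q * T + d)" by simp
    then show ?thesis using head_hold[OF that, of "Suc q"] Suc.IH[OF that(1,2)] by (metis prev_simps(2))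
  qed
  then have "delayed M R (iter_bodies \<Lambda> ! i) (?t + d) w = sat M w (inst (iter_fml \<Lambda> q) (iter_bodies \<Lambda> ! i))"
    using program_body[OF program Suc.prems(2)] by (intro delayed_sat[OF acc Suc.prems(1)]) auto
  moreover have "R (?t + d) w i = delayed M R (iter_bodies \<Lambda> ! i) (?t + d) w"
    using run[OF Suc.prems(1), of i "?t + d"] Suc.prems(2) tick[OF Suc.prems(1), of d "Suc q"]
      loaded[OF Suc.prems(1), of "?t + d"]
    by (simp add: updates_nth)
  ultimately show ?case by simp
qed

text \<open>\<open>Suc t div T\<close> counts the loads up to and including round \<open>t\<close>.
  As long as it is 0 every head is false, so nothing accepts too early.\<close>

lemma head_value:
  assumes "w \<in> worlds M" "i < heads \<Lambda>"
  shows "R t w i \<longleftrightarrow> 0 < Suc t div T \<and> sat M w (iter_fml \<Lambda> (Suc t div T - 1) i)"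
proof -
  define q r where "q = Suc t div T" and "r = Suc t mod T"
  have t: "Suc t = q * T + r" and r: "r \<le> d"
    using mod_less_divisor[of T "Suc t"] by (simp_all only: q_def r_def div_mult_mod_eq) simp
  have "R t w i = prev (\<lambda>t. R t w i) (q * T)"
    using head_hold[OF assms r, of q] t by (metis prev_simps(2))
  also have "\<dots> \<longleftrightarrow> 0 < q \<and> sat M w (iter_fml \<Lambda> (q - 1) i)"
  proof (cases q)
    case (Suc p)
    have "Suc p * T = Suc (p * T + d)" by simp
    then show ?thesis using Suc head_load[OF assms, of p] by (metis diff_Suc_1 prev_simps(2) zero_less_Suc)
  qed simp
  finally show ?thesis by (simp add: q_def)
qed

end

section \<open>Acceptance and output of the simulation\<close>

lemma accepts_in_unique: "accepts_in A b m \<Longrightarrow> accepts_in A b n \<Longrightarrow> m = n"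
  unfolding accepts_in_def by (metis linorder_neqE_nat)

text \<open>At attention positions the slow run is silent for \<open>T - 1\<close> rounds and then
  shows each entry of \<open>b\<close> for \<open>T\<close> rounds. It accepts at the first copy of
  entry \<open>n\<close>, because all earlier rounds are silent or show earlier entries.\<close>

lemma accepts_in_slowdown:
  assumes "0 < T" and "\<And>t i. i \<in> A \<Longrightarrow> b' t ! f i \<longleftrightarrow> 0 < Suc t div T \<and> b (Suc t div T - 1) ! i"
    and "accepts_in A b n"
  shows "accepts_in (f ` A) b' (Suc n * T - 1)"
proof -
  have "Suc (Suc n * T - 1) div T = Suc n" using assms(1) by (simp del: mult_Suc)
  then have "\<exists>i\<in>A. b' (Suc n * T - 1) ! f i"
    using assms(2)[where t = "Suc n * T - 1"] assms(3) by (simp add: accepts_in_def)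
  moreover have "\<not> b' m ! f i" if "m < Suc n * T - 1" "i \<in> A" for m i
  proof -
    have "Suc m div T < Suc n" using that(1) by (intro less_mult_imp_div_less) linarith
    then have "0 < Suc m div T \<Longrightarrow> Suc m div T - 1 < n" by linarith
    then show ?thesis using assms(2,3) that(2) by (auto simp: accepts_in_def)
  qed
  ultimately show ?thesis by (auto simp: accepts_in_def)
qed

text \<open>Existence is enough here, and a least round with an attention bit provides it; the exact
  round comes from \<open>accepts_in_slowdown\<close> and uniqueness.\<close>

lemma accepts_in_slowdownD:
  assumes "\<And>t i. i \<in> A \<Longrightarrow> b' t ! f i \<Longrightarrow> b (Suc t div T - 1) ! i"
    and "accepts_in (f ` A) b' t"
  shows "\<exists>n. accepts_in A b n"
proof -
  have "\<exists>n. \<exists>i\<in>A. b n ! i" using assms by (auto simp: accepts_in_def)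
  then have "accepts_in A b (LEAST n. \<exists>i\<in>A. b n ! i)"
    unfolding accepts_in_def by (rule conjI[OF LeastI_ex]) (blast dest: not_less_Least)
  then show ?thesis ..
qed

text \<open>Both sides are strictly increasing lists with the same elements.\<close>

lemma filter_image_upt:
  assumes "strict_mono f" "\<And>i. i < k \<Longrightarrow> f i < n" "P \<subseteq> {..<k}"
  shows "filter (\<lambda>i. i \<in> f ` P) [0..<n] = map f (filter (\<lambda>i. i \<in> P) [0..<k])"
proof (rule sorted_distinct_set_unique)
  show "sorted (map f (filter (\<lambda>i. i \<in> P) [0..<k]))"
    using strict_mono_mono[OF assms(1)] by (intro sorted_map_mono[OF _ mono_imp_mono_on]) (auto simp: sorted_wrt_filter)
  show "distinct (map f (filter (\<lambda>i. i \<in> P) [0..<k]))"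
    using strict_mono_imp_inj_on[OF assms(1)] by (auto simp: distinct_map intro: inj_on_subset)
qed (use assms(2,3) in \<open>auto simp: sorted_wrt_filter\<close>)

lemma nths_eq_map_filter: "nths xs P = map ((!) xs) (filter (\<lambda>i. i \<in> P) [0..<length xs])"
proof -
  have "zip xs [0..<length xs] = map (\<lambda>i. (xs ! i, i)) [0..<length xs]"
    by (rule nth_equalityI) auto
  then show ?thesis by (simp add: nths_def filter_map o_def)
qed


lemma nths_image:
  assumes "strict_mono f" "\<And>i. i < length ys \<Longrightarrow> f i < length xs" "P \<subseteq> {..<length ys}"
    and "\<And>i. i < length ys \<Longrightarrow> xs ! f i = ys ! i"
  shows "nths xs (f ` P) = nths ys P"
  using assms(4) by (simp add: nths_eq_map_filter filter_image_upt[OF assms(1-3)])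

section \<open>Size bounds\<close>

lemma fml_depth_le_size: "fml_depth \<phi> \<le> fml_size \<phi>"
  by (induction \<phi>) auto

lemma schema_depth_le_size: "schema_depth \<phi> \<le> schema_size \<phi>"
  by (induction \<phi>) auto

text \<open>Charges the clock registers to the size of the program.\<close>

lemma modal_depth_le_size:
  assumes "is_program \<Pi> \<Lambda>" shows "modal_depth \<Lambda> \<le> program_size \<Lambda>"
proof -
  have "term_bodies \<Lambda> \<noteq> []" using assms by (auto simp: is_program_def heads_def)
  moreover have "fml_depth \<phi> \<le> program_size \<Lambda>" if "\<phi> \<in> set (term_bodies \<Lambda>)" for \<phi>
    using fml_depth_le_size[of \<phi>] that
      member_le_sum_list[of "1 + fml_size \<phi>" "map (\<lambda>\<phi>. 1 + fml_size \<phi>) (term_bodies \<Lambda>)"]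
    by (simp add: program_size_def)
  moreover have "schema_depth \<psi> \<le> program_size \<Lambda>" if "\<psi> \<in> set (iter_bodies \<Lambda>)" for \<psi>
    using schema_depth_le_size[of \<psi>] that
      member_le_sum_list[of "1 + schema_size \<psi>" "map (\<lambda>\<psi>. 1 + schema_size \<psi>) (iter_bodies \<Lambda>)"]
    by (simp add: program_size_def)
  ultimately show ?thesis by (auto simp: modal_depth_def)
qed

lemma sum_list_map_nth: "sum_list (map f xs) = (\<Sum>i<length xs. f (xs ! i))"
  by (simp add: sum_list_sum_nth atLeast0LessThan)

lemma size_system_updates:
  assumes "is_program \<Pi> \<Lambda>"
  shows "start (updates \<Lambda>) (length (updates \<Lambda>)) \<le> 17 * program_size \<Lambda>"
proof -
  let ?k = "heads \<Lambda>" and ?d = "modal_depth \<Lambda>"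
  define s where "s = (\<Sum>i<?k. schema_size (iter_bodies \<Lambda> ! i)) + (\<Sum>i<?k. fml_size (term_bodies \<Lambda> ! i))"
  have one: "schema_size (clock_ge \<Lambda> j) = 1" for j by (simp add: clock_ge_def)
  have "start (updates \<Lambda>) (length (updates \<Lambda>)) = 4 + sum_list (map schema_size (updates \<Lambda>))"
    by (simp add: start_def sum_list_map_nth del: length_updates)
  \<comment> \<open>Per head, two conditionals cost 7 + 2 each and the held variable 1, besides the
    bodies. A clock register costs 4, the prelude 4 and the loading flag 6.\<close>
  also have "\<dots> = 10 + 19 * ?k + s + 4 * ?d"
    by (simp add: updates_def o_def one interv_sum_list_conv_sum_set_nat atLeast0LessThan
        sum.distrib s_def sum_list_triv)
  finally have start: "start (updates \<Lambda>) (length (updates \<Lambda>)) = 10 + 19 * ?k + s + 4 * ?d" .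
  have "length (iter_bodies \<Lambda>) = ?k" "length (term_bodies \<Lambda>) = ?k" "1 \<le> ?k"
    using assms by (auto simp: is_program_def heads_def)
  then have size: "program_size \<Lambda> = 2 * ?k + s"
    by (simp add: program_size_def sum_list_map_nth sum_Suc s_def)
  have "(\<Sum>i<?k. 1) \<le> (\<Sum>i<?k. schema_size (iter_bodies \<Lambda> ! i))"
    by (intro sum_mono) (simp add: Suc_leI schema_size_pos)
  moreover have "(\<Sum>i<?k. 1) \<le> (\<Sum>i<?k. fml_size (term_bodies \<Lambda> ! i))"
    by (intro sum_mono) (metis One_nat_def Suc_leI schema_of_simps(4) schema_size_pos)
  ultimately have "2 * ?k \<le> s" by (simp add: s_def)
  \<comment> \<open>By \<open>1 \<le> ?k\<close> and the depth bound the total is at most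
    \<open>37 * ?k + 5 * s\<close>, which \<open>2 * ?k \<le> s\<close> puts below
    \<open>17 * (2 * ?k + s)\<close>; the factor is not optimal.\<close>
  then show ?thesis using start size modal_depth_le_size[OF assms] \<open>1 \<le> ?k\<close> by linarith
qed

theorem theorem6:
  fixes I :: "'p::{countable, linorder} set"
  assumes "infinite (UNIV :: 'p set)"
  shows "\<exists>c\<^sub>1 c\<^sub>2 :: nat. \<forall>(\<Pi> :: 'p set) (\<Delta> :: nat) (\<Lambda> :: 'p program).
           finite \<Pi> \<longrightarrow> is_program \<Pi> \<Lambda> \<longrightarrow>
           (\<exists>N. is_mpc \<Pi> \<Delta> N \<and>
                mpc_size N \<le> c\<^sub>1 * (max 1 \<Delta> * program_size \<Lambda> + card \<Pi>) \<and>
                equivalent I \<Pi> \<Delta> \<Lambda> N \<and>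
                simulation_time_le c\<^sub>2 I \<Pi> \<Delta> \<Lambda> N)"
proof (rule exI[of _ 68], rule exI[of _ 2], intro allI impI)
  fix \<Pi> :: "'p set" and \<Delta> :: nat and \<Lambda> :: "'p program"
  assume fin: "finite \<Pi>" and prog: "is_program \<Pi> \<Lambda>"
  let ?us = "updates \<Lambda>" and ?k = "heads \<Lambda>" and ?d = "modal_depth \<Lambda>"
  let ?f = "root ?us" and ?W = "start (updates \<Lambda>) (length (updates \<Lambda>))"
  note wf = updates_wf[OF prog]
  interpret cell_array \<Pi> \<Delta> "system_cells \<Pi> ?us"
    using fin wf by (rule cell_array_system)
  define N where "N = array_mpc (?f ` att_heads \<Lambda>) (?f ` print_heads \<Lambda>)"
  have heads: "att_heads \<Lambda> \<subseteq> {..<?k}" "print_heads \<Lambda> \<subseteq> {..<?k}"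
    using prog by (auto simp: is_program_def)
  have f: "?f i < ?W" if "i < ?k" for i
    using that by (intro root_less_start) simp
  have mpc: "is_mpc \<Pi> \<Delta> N"
    unfolding N_def using heads f by (intro is_mpc_array) (auto simp: length_system_cells)
  \<comment> \<open>Each cell accounts for \<Delta> + 1 inputs, its own gate and an output copy. The
    factor 4 covers \<Delta> + 3, whence 68 = 17 * 4.\<close>
  have "?W * (\<Delta> + 3) \<le> 17 * program_size \<Lambda> * (4 * max 1 \<Delta>)"
    using size_system_updates[OF prog] by (intro mult_le_mono) auto
  then have "mpc_size N \<le> 68 * (max 1 \<Delta> * program_size \<Lambda> + card \<Pi>)"
    by (simp add: N_def mpc_size_array length_system_cells algebra_simps)
  moreover have sim: "(program_accepts_in \<Lambda> M w n \<longrightarrow> mpc_accepts_in I \<Pi> \<Delta> N M w (Suc n * Suc ?d - 1) \<and>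
        nths (mpc_conf I \<Pi> \<Delta> N M (Suc n * Suc ?d - 1) w) (print_bits N) =
        nths (program_conf \<Lambda> M n w) (print_heads \<Lambda>)) \<and>
      (mpc_accepts_in I \<Pi> \<Delta> N M w t \<longrightarrow> (\<exists>n. program_accepts_in \<Lambda> M w n))"
    if M: "M \<in> \<K> I \<Pi> \<Delta>" and w: "w \<in> worlds M" for M :: "(nat, 'p) kripke" and w n t
  proof -
    interpret simulation \<Pi> \<Lambda> M "\<lambda>t w j. mpc_conf I \<Pi> \<Delta> N M t w ! ?f j"
      using M prog system_conf[OF fin wf M]
      by unfold_locales (simp_all add: \<K>_def kripke_over_def N_def)
    have conf: "mpc_conf I \<Pi> \<Delta> N M t w ! ?f i \<longleftrightarrow>
        0 < Suc t div T \<and> program_conf \<Lambda> M (Suc t div T - 1) w ! i" if "i < ?k" for i t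
      using head_value[OF w that] that by (simp add: program_conf_def)
    have "nths (mpc_conf I \<Pi> \<Delta> N M (Suc n * T - 1) w) (?f ` print_heads \<Lambda>) =
        nths (program_conf \<Lambda> M n w) (print_heads \<Lambda>)"
    proof (rule nths_image[OF strict_mono_root])
      have "Suc (Suc n * T - 1) = Suc n * T" by simp
      then have "Suc (Suc n * T - 1) div T = Suc n"
        using nonzero_mult_div_cancel_right[of T "Suc n"] by (metis Zero_not_Suc)
      then show "mpc_conf I \<Pi> \<Delta> N M (Suc n * T - 1) w ! ?f i = program_conf \<Lambda> M n w ! i"
        if "i < length (program_conf \<Lambda> M n w)" for i
        using conf[of i "Suc n * T - 1"] that by (simp add: program_conf_def)
    qed (use f heads in \<open>auto simp: program_conf_def length_mpc_conf N_def length_system_cells\<close>)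
    moreover have "accepts_in (?f ` att_heads \<Lambda>) (\<lambda>t. mpc_conf I \<Pi> \<Delta> N M t w) (Suc n * T - 1)"
      if "accepts_in (att_heads \<Lambda>) (\<lambda>n. program_conf \<Lambda> M n w) n"
      using that conf heads(1) by (intro accepts_in_slowdown) auto
    moreover have "\<exists>n. accepts_in (att_heads \<Lambda>) (\<lambda>n. program_conf \<Lambda> M n w) n"
      if "accepts_in (?f ` att_heads \<Lambda>) (\<lambda>t. mpc_conf I \<Pi> \<Delta> N M t w) t"
      using conf heads(1) that by (intro accepts_in_slowdownD[OF _ that]) auto
    moreover have "att_bits N = ?f ` att_heads \<Lambda>" "print_bits N = ?f ` print_heads \<Lambda>"
      by (simp_all add: N_def array_mpc_def)
    ultimately show ?thesis by (simp add: program_accepts_in_def mpc_accepts_in_def)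
  qed
  moreover have "equivalent I \<Pi> \<Delta> \<Lambda> N"
    unfolding equivalent_def program_outputs_def mpc_outputs_def outputs_def
    using sim unfolding program_accepts_in_def mpc_accepts_in_def by metis
  moreover have "simulation_time_le 2 I \<Pi> \<Delta> \<Lambda> N"
    unfolding simulation_time_le_def
  proof (intro allI impI ballI, elim conjE)
    fix M :: "(nat, 'p) kripke" and w n t
    assume *: "M \<in> \<K> I \<Pi> \<Delta>" "w \<in> worlds M" "program_accepts_in \<Lambda> M w n"
      "mpc_accepts_in I \<Pi> \<Delta> N M w t"
    then have "t = Suc n * Suc ?d - 1"
      using sim[OF *(1,2)] accepts_in_unique unfolding mpc_accepts_in_def by metis
    \<comment> \<open>\<open>d\<close> rounds precede the first load and each further update takes
      \<open>d + 1\<close>. Both \<open>n\<close> and \<open>n * d\<close> are at most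
      \<open>n * max 1 d\<close>, whence the factor 2.\<close>
    then have "t = n * 1 + n * ?d + ?d" by simp
    also have "\<dots> \<le> n * max 1 ?d + n * max 1 ?d + (?d + ?d)" by (intro add_mono mult_le_mono) simp_all
    also have "\<dots> = 2 * (max 1 ?d * n + ?d)" by (simp only: mult.commute[of n] mult_2 add_ac)
    finally show "t \<le> 2 * (max 1 ?d * n + ?d)" .
  qed
  ultimately show "\<exists>N. is_mpc \<Pi> \<Delta> N \<and> mpc_size N \<le> 68 * (max 1 \<Delta> * program_size \<Lambda> + card \<Pi>) \<and>
      equivalent I \<Pi> \<Delta> \<Lambda> N \<and> simulation_time_le 2 I \<Pi> \<Delta> \<Lambda> N"
    using mpc by blast
qed

end
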